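(* Let $(a,b)\in\partial\mathcal{H}$ with $0<b<1$ and $a+b>1$, where $\mathcal{H}$ is the set of all parameters $(a,b)$ with $a>0$, $0<b<1$ for which the Lozi map $L_{a,b}$ has homoclinic points for its fixed point $X$ in the first quadrant. Then no intersection point of $W_X^u$ and $W_X^s$ different from $X$ is transverse; that is, away from $X$, $W_X^u$ and $W_X^s$ intersect tangentially or along a segment.
   Context: The Lozi map is the homeomorphism $L_{a,b}(x,y)=(1+y-a|x|,\,bx)$ of $\mathbb{R}^2$. For $0<b<1$, $a+b>1$ it has the hyperbolic saddle fixed point $X=\bigl(\frac{1}{1+a-b},\frac{b}{1+a-b}\bigr)$. Put $A^k=L_{a,b}^k(A)$. The unstable and stable manifolds $W_X^u=\{T:T^{-n}\to X\}$ and $W_X^s=\{T:T^n\to X\}$ (as $n\to\infty$) are polygonal lines. A homoclinic point for $X$ is a point $T\ne X$ in $W_X^s\cap W_X^u$. $\partial\mathcal{H}$ is the boundary of $\mathcal{H}$ in the parameter plane $\mathbb{R}^2$. Types of intersection: let $\eta,\xi$ be polygonal lines in the plane meeting at a point $T$ that is isolated from other intersection points of $\eta$ and $\xi$ in their respective (intrinsic) topologies. For $\varepsilon>0$ let $\eta_{T,\varepsilon},\xi_{T,\varepsilon}$ be the connected components of $\eta\cap B_\varepsilon(T)$, $\xi\cap B_\varepsilon(T)$ containing $T$, where $B_\varepsilon(T)$ is the open disc of radius $\varepsilon$ about $T$. The intersection at $T$ is tangential if there is $\varepsilon>0$ such that $B_\varepsilon(T)\setminus\eta_{T,\varepsilon}$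 has exactly two connected components and $\xi_{T,\varepsilon}\setminus\{T\}$ is contained in only one of them; otherwise it is transverse. If the intersection point is not isolated, $\eta$ and $\xi$ intersect along a (straight or polygonal) segment, i.e. a nondegenerate arc contained in both. *)

theory Defs
  imports "HOL-Analysis.Analysis"
begin

section \<open>The Lozi map and its homoclinic points\<close>

definition lozi :: "real \<Rightarrow> real \<Rightarrow> real \<times> real \<Rightarrow> real \<times> real" where
  "lozi a b = (\<lambda>(x, y). (1 + y - a * \<bar>x\<bar>, b * x))"

lemma bij_lozi:
  assumes "b \<noteq> 0"
  shows "bij (lozi a b)"
proof (rule o_bij)
  let ?g = "\<lambda>(u, v). (v / b, u - 1 + a * \<bar>v / b\<bar>)"
  show "?g \<circ> lozi a b = id" "lozi a b \<circ> ?g = id"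
    using assms by (auto simp: lozi_def fun_eq_iff abs_mult)
qed

definition lozi_fix :: "real \<Rightarrow> real \<Rightarrow> real \<times> real" where
  "lozi_fix a b = (1 / (1 + a - b), b / (1 + a - b))"

lemma lozi_lozi_fix:
  assumes "1 + a - b > 0"
  shows "lozi a b (lozi_fix a b) = lozi_fix a b"
proof -
  have "\<bar>1 / (1 + a - b)\<bar> = 1 / (1 + a - b)"
    using assms by simp
  then show ?thesis
    unfolding lozi_def lozi_fix_def prod.case prod.inject
    using assms by (simp add: divide_simps)
qed

definition stable_mfd :: "real \<Rightarrow> real \<Rightarrow> (real \<times> real) set" where
  "stable_mfd a b = {T. (\<lambda>n. (lozi a b ^^ n) T) \<longlonglongrightarrow> lozi_fix a b}"

definition unstable_mfd :: "real \<Rightarrow> real \<Rightarrow> (real \<times> real) set" where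
  "unstable_mfd a b = {T. (\<lambda>n. (inv (lozi a b) ^^ n) T) \<longlonglongrightarrow> lozi_fix a b}"

definition homoclinic_point :: "real \<Rightarrow> real \<Rightarrow> real \<times> real \<Rightarrow> bool" where
  "homoclinic_point a b T \<longleftrightarrow>
     T \<noteq> lozi_fix a b \<and> T \<in> stable_mfd a b \<and> T \<in> unstable_mfd a b"

definition homoclinic_params :: "(real \<times> real) set" where
  "homoclinic_params = {(a, b). 0 < a \<and> 0 < b \<and> b < 1 \<and> (\<exists>T. homoclinic_point a b T)}"

section \<open>Types of intersection of polygonal lines\<close>

text \<open>
  A polygonal line such as the unstable manifold is an injective image of the real line, but it
  may accumulate on itself, so its subspace topology is in general coarser than its intrinsic
  topology. The latter is recovered without choosing a parametrization as the finest topology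
  on the set \<open>S\<close> that makes all plane paths lying in \<open>S\<close> continuous: by Sierpinski's theorem on
  countable unions of disjoint closed sets, a path in \<open>S\<close> cannot jump between the countably many
  arcs in which the line meets a small closed disc.
\<close>

definition intrinsic_topology :: "'a::topological_space set \<Rightarrow> 'a topology" where
  "intrinsic_topology S = topology (\<lambda>U. U \<subseteq> S \<and>
     (\<forall>g. path g \<and> path_image g \<subseteq> S \<longrightarrow>
        openin (top_of_set {0..1::real}) ({0..1} \<inter> g -` U)))"

lemma openin_intrinsic_topology:
  "openin (intrinsic_topology S) U \<longleftrightarrow> U \<subseteq> S \<and>
     (\<forall>g. path g \<and> path_image g \<subseteq> S \<longrightarrow>
        openin (top_of_set {0..1::real}) ({0..1} \<inter> g -` U))"
proof -
  let ?P = "\<lambda>U. U \<subseteq> S \<and> (\<forall>g. path g \<and> path_image g \<subseteq> S \<longrightarrow>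
        openin (top_of_set {0..1::real}) ({0..1} \<inter> g -` U))"
  have "istopology ?P"
    unfolding istopology_def
  proof (intro conjI allI impI)
    fix U V and g :: "real \<Rightarrow> 'a"
    assume "?P U" "?P V" "path g \<and> path_image g \<subseteq> S"
    then have "openin (top_of_set {0..1}) (({0..1} \<inter> g -` U) \<inter> ({0..1} \<inter> g -` V))"
      by blast
    moreover have "({0..1} \<inter> g -` U) \<inter> ({0..1} \<inter> g -` V) = {0..1} \<inter> g -` (U \<inter> V)"
      by blast
    ultimately show "openin (top_of_set {0..1}) ({0..1} \<inter> g -` (U \<inter> V))"
      by simp
  next
    fix K and g :: "real \<Rightarrow> 'a"
    assume "\<forall>U\<in>K. ?P U" "path g \<and> path_image g \<subseteq> S"
    then have "openin (top_of_set {0..1}) (\<Union>U\<in>K. {0..1} \<inter> g -` U)"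
      by blast
    moreover have "(\<Union>U\<in>K. {0..1} \<inter> g -` U) = {0..1} \<inter> g -` \<Union>K"
      by blast
    ultimately show "openin (top_of_set {0..1}) ({0..1} \<inter> g -` \<Union>K)"
      by simp
  qed blast+
  then show ?thesis
    by (simp add: intrinsic_topology_def)
qed

definition local_part :: "'a::metric_space set \<Rightarrow> 'a \<Rightarrow> real \<Rightarrow> 'a set" where
  "local_part \<eta> T \<epsilon> =
     connected_component_of_set (subtopology (intrinsic_topology \<eta>) (ball T \<epsilon>)) T"

text \<open>
  Isolation is local along both lines: \<open>T\<close> may be a limit of intersection points that are close
  to \<open>T\<close> along one line but far from \<open>T\<close> along the other, as happens in homoclinic tangles.
\<close>

definition isolated_intersection :: "'a::metric_space set \<Rightarrow> 'a set \<Rightarrow> 'a \<Rightarrow> bool" where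
  "isolated_intersection \<eta> \<xi> T \<longleftrightarrow>
     (\<exists>U V. openin (intrinsic_topology \<eta>) U \<and> openin (intrinsic_topology \<xi>) V \<and> U \<inter> V = {T})"

definition tangential_intersection :: "'a::metric_space set \<Rightarrow> 'a set \<Rightarrow> 'a \<Rightarrow> bool" where
  "tangential_intersection \<eta> \<xi> T \<longleftrightarrow> isolated_intersection \<eta> \<xi> T \<and>
     (\<exists>\<epsilon>>0. card (components (ball T \<epsilon> - local_part \<eta> T \<epsilon>)) = 2 \<and>
        (\<exists>C \<in> components (ball T \<epsilon> - local_part \<eta> T \<epsilon>). local_part \<xi> T \<epsilon> - {T} \<subseteq> C))"

definition transverse_intersection :: "'a::metric_space set \<Rightarrow> 'a set \<Rightarrow> 'a \<Rightarrow> bool" where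
  "transverse_intersection \<eta> \<xi> T \<longleftrightarrow>
     isolated_intersection \<eta> \<xi> T \<and> \<not> tangential_intersection \<eta> \<xi> T"

definition intersect_along_segment :: "'a::topological_space set \<Rightarrow> 'a set \<Rightarrow> 'a \<Rightarrow> bool" where
  "intersect_along_segment \<eta> \<xi> T \<longleftrightarrow>
     (\<exists>g. arc g \<and> T \<in> path_image g \<and> path_image g \<subseteq> \<eta> \<inter> \<xi>)"

end

theory Submission
  imports Defs
begin

text \<open>
  The proof shows that a transverse homoclinic intersection survives small changes of the parameters,
  so that its parameter pair is an interior point of the set of homoclinic parameters.

  \<^item> Pushing the eigenlines of the fixed point \<open>X\<close> forward and backward parametrizes the unstable and
  the stable manifold by injective curves \<open>line\<close> on which the Lozi map or its inverse acts as
  multiplication by an eigenvalue. Since the map is piecewise affine, these curves consist of straight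
  segments locally.

  \<^item> The intrinsic topology of such a curve is that of its parameter (\<open>openin_intrinsic_iff\<close>), provided
  that no end of the curve converges to a point of the curve. For a saddle whose eigenvalues have
  opposite signs this is a parity argument (\<open>no_limit\<close>). Consequently the local parts of the manifolds
  in a small disc are pairs of radii, and a disc cut along two radii has exactly two components.

  \<^item> If an intersection point \<open>T\<close> is not isolated, a radius of one manifold overlaps a radius of the
  other (\<open>not_isolated_imp_segment\<close>). If it is isolated, some inverse iterate carries it to the straight
  part of the unstable manifold. The intersection at \<open>T\<close> is tangential as soon as the stable manifold
  stays on one side of this straight line there (\<open>tangential_or_crossing\<close>).

  \<^item> Otherwise a linear form, vanishing on the unstable eigenline, changes its sign along an arc of the
  stable manifold. Form and arc vary continuously with the parameters, so the intermediate value
  theorem provides homoclinic points for all nearby parameters (\<open>crossing_imp_interior\<close>). At a boundary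
  point of the set of homoclinic parameters this cannot happen.
\<close>

section \<open>The intrinsic topology of an injectively immersed line\<close>

text \<open>
  The two hypotheses on limits exclude a figure six, whose loose end runs back into the line: there
  a path can pass from the end to the point that it approaches, and the intrinsic topology is
  coarser than that of the parameter. Accumulation on the line without convergence is allowed.
\<close>

locale injective_line =
  fixes \<phi> :: "real \<Rightarrow> 'a::metric_space"
  assumes cont: "continuous_on UNIV \<phi>"
    and inj: "inj \<phi>"
    and no_limit_top: "L \<in> range \<phi> \<Longrightarrow> \<not> (\<phi> \<longlongrightarrow> L) at_top"
    and no_limit_bot: "L \<in> range \<phi> \<Longrightarrow> \<not> (\<phi> \<longlongrightarrow> L) at_bot"

text \<open>
  A lift \<open>h\<close> of a plane path can fail to be continuous at \<open>u\<close> only by escaping. If it stayed above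
  \<open>c\<close> on all of \<open>{u<..t}\<close>, it could accumulate at no finite parameter \<open>x \<ge> c\<close>, because
  \<open>\<phi> x = \<phi> (h u)\<close> contradicts injectivity; hence it would tend to infinity and drag \<open>\<phi>\<close> to the limit
  \<open>\<phi> (h u)\<close> along the whole end of the line.
\<close>

lemma lift_meets_level:
  fixes \<phi> :: "real \<Rightarrow> 'a::metric_space" and h :: "real \<Rightarrow> real"
  assumes cont: "continuous_on UNIV \<phi>" and inj: "inj \<phi>"
    and nolim: "\<And>L. L \<in> range \<phi> \<Longrightarrow> \<not> (\<phi> \<longlongrightarrow> L) at_top"
    and ut: "u < t" and hc: "continuous_on {u<..t} h"
    and lim: "((\<lambda>s. \<phi> (h s)) \<longlongrightarrow> \<phi> (h u)) (at_right u)"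
    and hu: "h u < c" and ht: "c < h t"
  shows "\<exists>s\<in>{u<..t}. h s = c"
proof (rule ccontr)
  assume no: "\<not> (\<exists>s\<in>{u<..t}. h s = c)"
  have above: "c < h s" if s: "s \<in> {u<..t}" for s
  proof (rule ccontr)
    assume "\<not> c < h s"
    then have "h s \<le> c" by simp
    moreover have "continuous_on {s..t} h"
      using hc by (rule continuous_on_subset) (use s in auto)
    ultimately obtain x where "x \<ge> s" "x \<le> t" "h x = c"
      using IVT'[of h s c t] ht s by auto
    then show False using no s by auto
  qed
  have near: "eventually (\<lambda>s. s \<in> {u<..t}) (at_right u)"
    using ut by (auto simp: eventually_at_right_field intro!: exI[of _ t])
  have infty: "eventually (\<lambda>s. M < h s) (at_right u)" for M
  proof -
    have "compact (\<phi> ` {c..M})"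
      by (intro compact_continuous_image continuous_on_subset[OF cont]) auto
    then have "open (- \<phi> ` {c..M})" by (simp add: compact_imp_closed open_Compl)
    moreover have "\<phi> (h u) \<in> - \<phi> ` {c..M}"
      using hu by (auto dest: injD[OF inj])
    ultimately have "eventually (\<lambda>s. \<phi> (h s) \<in> - \<phi> ` {c..M}) (at_right u)"
      using lim topological_tendstoD by blast
    then show ?thesis using near
    proof eventually_elim
      case (elim s)
      then have "h s \<notin> {c..M}" by blast
      then show ?case using above[of s] elim by simp
    qed
  qed
  have "(\<phi> \<longlongrightarrow> \<phi> (h u)) at_top"
  proof (rule topological_tendstoI)
    fix S assume S: "open S" "\<phi> (h u) \<in> S"
    then have "eventually (\<lambda>s. \<phi> (h s) \<in> S) (at_right u)"
      using lim topological_tendstoD by blast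
    then obtain b where b: "u < b" "\<And>s. u < s \<Longrightarrow> s < b \<Longrightarrow> \<phi> (h s) \<in> S"
      by (auto simp: eventually_at_right_field)
    define s1 where "s1 = min t ((u + b) / 2)"
    have s1: "u < s1" "s1 < b" "s1 \<le> t" using b(1) ut by (auto simp: s1_def min_def)
    have "\<phi> x \<in> S" if x: "x \<ge> h s1" for x
    proof -
      obtain e where e: "u < e" "\<And>s. u < s \<Longrightarrow> s < e \<Longrightarrow> x < h s"
        using infty[of x] by (auto simp: eventually_at_right_field)
      define s2 where "s2 = min s1 ((u + e) / 2)"
      have s2: "u < s2" "s2 < e" "s2 \<le> s1" using e(1) s1 by (auto simp: s2_def min_def)
      have "continuous_on {s2..s1} h"
        using hc by (rule continuous_on_subset) (use s1 s2 in auto)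
      then obtain y where "s2 \<le> y" "y \<le> s1" "h y = x"
        using IVT2'[of h s1 x s2] x e(2)[of s2] s2 by auto
      then show ?thesis using b(2)[of y] s1 s2 by auto
    qed
    then show "eventually (\<lambda>x. \<phi> x \<in> S) at_top"
      using eventually_at_top_linorder by blast
  qed
  then show False using nolim by blast
qed

context injective_line
begin

lemma inv_cont_on_compact: "compact K \<Longrightarrow> continuous_on (\<phi> ` K) (inv \<phi>)"
  by (rule continuous_on_inv) (use cont inj in \<open>auto intro: continuous_on_subset\<close>)

lemma reflect: "injective_line (\<lambda>t. \<phi> (- t))"
proof
  show "continuous_on UNIV (\<lambda>t. \<phi> (- t))"
    by (intro continuous_on_compose2[OF cont] continuous_intros) auto
  show "inj (\<lambda>t. \<phi> (- t))" by (rule injI) (use injD[OF inj] in fastforce)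
  fix L assume "L \<in> range (\<lambda>t. \<phi> (- t))"
  then have L: "L \<in> range \<phi>" by auto
  show "\<not> ((\<lambda>t. \<phi> (- t)) \<longlongrightarrow> L) at_top"
    using no_limit_bot[OF L] by (simp add: filterlim_at_bot_mirror)
  show "\<not> ((\<lambda>t. \<phi> (- t)) \<longlongrightarrow> L) at_bot"
    using no_limit_top[OF L] by (simp add: filterlim_at_top_mirror)
qed

text \<open>
  Where the lift is locally bounded it is continuous, since \<open>\<phi>\<close> is an embedding on compact
  intervals. By Baire, the closed set \<open>D\<close> of points of local unboundedness, if nonempty, has a
  portion on which the lift is bounded by some \<open>n\<close>. On the gaps of \<open>D\<close> in this portion the lift is
  continuous and starts from values at most \<open>n\<close>, so an excursion beyond \<open>n + 2\<close> passes the levels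
  \<open>n + 1\<close> and \<open>n + 2\<close>; on a short interval this is incompatible with the continuity of \<open>g\<close>, as \<open>\<phi>\<close>
  has different values there. So the lift is locally bounded on the portion after all.
\<close>

lemma lift_continuous:
  fixes g :: "real \<Rightarrow> 'a"
  assumes g: "continuous_on {0..1} g" and sub: "g ` {0..1} \<subseteq> range \<phi>"
  shows "continuous_on {0..1} (\<lambda>t. inv \<phi> (g t))"
proof -
  define h where "h = (\<lambda>t. inv \<phi> (g t))"
  have \<phi>h: "\<phi> (h t) = g t" if "t \<in> {0..1}" for t
    using sub that by (auto simp: h_def f_inv_into_f image_subset_iff)
  define E where "E n = {t\<in>{0..1}. \<bar>h t\<bar> \<le> real n}" for n
  have E_eq: "E n = {t\<in>{0..1}. g t \<in> \<phi> ` {- real n..real n}}" for n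
  proof -
    have "g t \<in> \<phi> ` {- real n..real n} \<longleftrightarrow> \<bar>h t\<bar> \<le> real n" if "t \<in> {0..1}" for t
      unfolding \<phi>h[OF that, symmetric] inj_image_mem_iff[OF inj] by (simp add: abs_le_iff) linarith
    then show ?thesis by (auto simp: E_def)
  qed
  have closedE: "closed (E n)" for n
  proof -
    have "closed (\<phi> ` {- real n..real n})"
      by (intro compact_imp_closed compact_continuous_image continuous_on_subset[OF cont]) auto
    then have "closed ({0..1} \<inter> g -` (\<phi> ` {- real n..real n}))"
      by (intro continuous_closed_preimage[OF g]) auto
    moreover have "E n = {0..1} \<inter> g -` (\<phi> ` {- real n..real n})"
      unfolding E_eq vimage_def Int_def by (simp only: mem_Collect_eq)
    ultimately show ?thesis by (simp only:)
  qed
  have hE: "continuous_on (E n) h" for n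
    unfolding h_def
  proof (rule continuous_on_compose2[where f = g and g = "inv \<phi>"])
    show "continuous_on (\<phi> ` {- real n..real n}) (inv \<phi>)"
      by (rule inv_cont_on_compact) simp
    show "continuous_on (E n) g"
      using g by (rule continuous_on_subset) (auto simp: E_def)
    show "g ` E n \<subseteq> \<phi> ` {- real n..real n}"
      unfolding E_eq by (rule image_subsetI) (simp only: mem_Collect_eq)
  qed
  define bdd where "bdd t \<longleftrightarrow> (\<exists>d>0. \<exists>n. \<forall>s\<in>{0..1}. dist s t < d \<longrightarrow> \<bar>h s\<bar> \<le> real n)" for t
  have cont_at: "continuous (at t within {0..1}) h" if t: "t \<in> {0..1}" "bdd t" for t
  proof -
    obtain d n where d: "d > 0" "\<And>s. s \<in> {0..1} \<Longrightarrow> dist s t < d \<Longrightarrow> \<bar>h s\<bar> \<le> real n"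
      using t(2) unfolding bdd_def by blast
    have "at t within {0..1} = at t within E n"
      by (rule at_within_nhd[of _ "ball t d"])
        (use d in \<open>auto simp: E_def dist_commute\<close>)
    moreover have "t \<in> E n" using d t by (auto simp: E_def)
    ultimately show ?thesis
      using hE continuous_on_eq_continuous_within by metis
  qed
  define D where "D = {t\<in>{0..1}. \<not> bdd t}"
  have openB: "bdd s" if "bdd t" "dist s t < d" "d > 0"
      "\<forall>s\<in>{0..1}. dist s t < d \<longrightarrow> \<bar>h s\<bar> \<le> real n" for s t d n
    unfolding bdd_def
  proof (intro exI conjI ballI impI)
    show "0 < d - dist s t" using that by simp
    fix x assume "x \<in> {0..1}" "dist x s < d - dist s t"
    then show "\<bar>h x\<bar> \<le> real n" using that(4) dist_triangle[of x t s] by force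
  qed
  have "open {t. bdd t}"
    unfolding open_dist
  proof
    fix t assume "t \<in> {t. bdd t}"
    then have t: "bdd t" by simp
    then obtain d n where "d > 0" "\<forall>s\<in>{0..1}. dist s t < d \<longrightarrow> \<bar>h s\<bar> \<le> real n"
      unfolding bdd_def by blast
    then show "\<exists>e>0. \<forall>s. dist s t < e \<longrightarrow> s \<in> {t. bdd t}"
      using openB[OF t] by blast
  qed
  then have closedD: "closed D"
  proof -
    have "D = {0..1} - {t. bdd t}" by (auto simp: D_def)
    then show ?thesis using \<open>open {t. bdd t}\<close> by (simp add: closed_Diff)
  qed
  have "D = {}"
  proof (rule ccontr)
    assume ne: "D \<noteq> {}"
    have "\<exists>n. \<not> D \<subseteq> closure (D - E n)"
    proof (rule ccontr)
      assume "\<not> ?thesis"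
      then have dense: "D \<subseteq> closure (D - E n)" for n by blast
      have "D \<subseteq> closure (\<Inter>n. D - E n)"
      proof (rule Baire[OF closedD])
        fix T assume "T \<in> range (\<lambda>n. D - E n)"
        then obtain n where T: "T = D - E n" by blast
        have "openin (top_of_set D) (D - E n)"
          using openin_open_Int[of "- E n" D] closedE[of n] by (simp add: Diff_eq open_Compl)
        then show "openin (top_of_set D) T \<and> D \<subseteq> closure T" using T dense by simp
      qed simp
      moreover have "(\<Inter>n. D - E n) = {}"
      proof -
        have "\<exists>n. t \<in> E n" if "t \<in> D" for t
          using that real_arch_simple[of "\<bar>h t\<bar>"] by (auto simp: E_def D_def)
        then show ?thesis by blast
      qed
      ultimately show False using ne by (metis closure_empty subset_empty)
    qed
    then obtain n d where d: "d \<in> D" "d \<notin> closure (D - E n)" by blast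
    then obtain e where e: "e > 0" "\<And>s. s \<in> D \<Longrightarrow> dist s d < e \<Longrightarrow> \<bar>h s\<bar> \<le> real n"
      unfolding closure_approachable D_def E_def by auto
    define c where "c = real n + 1"
    \<comment> \<open>Twice \<open>\<rho>\<close> is too small a distance to get from level \<open>c\<close> to level \<open>c + 1\<close>, on either end of the line.\<close>
    define \<rho> where "\<rho> = min (dist (\<phi> c) (\<phi> (c + 1))) (dist (\<phi> (- c)) (\<phi> (- (c + 1)))) / 2"
    have "\<rho> > 0" by (auto simp: \<rho>_def inj_eq[OF inj])
    moreover have d01: "d \<in> {0..1}" using d by (auto simp: D_def)
    ultimately obtain \<delta>0 where \<delta>0: "\<delta>0 > 0"
      "\<And>s. s \<in> {0..1} \<Longrightarrow> dist s d < \<delta>0 \<Longrightarrow> dist (g s) (g d) < \<rho>"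
      using g unfolding continuous_on_iff by metis
    define \<delta> where "\<delta> = min \<delta>0 e"
    have \<delta>: "\<delta> > 0" using \<delta>0 e by (simp add: \<delta>_def)
    \<comment> \<open>The sign \<open>\<sigma>\<close> selects the end of the line and \<open>\<tau>\<close> the side of \<open>d\<close>.\<close>
    have bound: "\<sigma> * h (d + \<tau> * x) \<le> c + 1"
      if \<sigma>: "\<sigma> \<in> {1, - 1}" and \<tau>: "\<tau> \<in> {1, - 1}" and x: "0 \<le> x" "x < \<delta>" "d + \<tau> * x \<in> {0..1}"
      for \<sigma> \<tau> x :: real
    proof (rule ccontr)
      assume "\<not> ?thesis"
      then have big: "\<sigma> * h (d + \<tau> * x) > c + 1" by simp
      define H where "H s = \<sigma> * h (d + \<tau> * s)" for s
      have in01: "d + \<tau> * s \<in> {0..1}" if "s \<in> {0..x}" for s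
        using that \<tau> d01 x(3) by auto
      have distd: "dist (d + \<tau> * s) d < \<delta>" if "s \<in> {0..x}" for s
        using that \<tau> x by (auto simp: dist_real_def)
      define Z where "Z = {s\<in>{0..x}. d + \<tau> * s \<in> D}"
      have "Z = {0..x} \<inter> (\<lambda>s. d + \<tau> * s) -` D" by (auto simp: Z_def)
      moreover have "closed ({0..x} \<inter> (\<lambda>s. d + \<tau> * s) -` D)"
        by (intro continuous_closed_preimage continuous_intros closedD)
      ultimately have "compact Z"
        by (metis bounded_closed_interval bounded_subset compact_eq_bounded_closed inf_le1)
      moreover have "0 \<in> Z" using d x by (simp add: Z_def)
      \<comment> \<open>The last point of \<open>D\<close> before the excursion.\<close>
      ultimately obtain u where u: "u \<in> Z" "\<And>s. s \<in> Z \<Longrightarrow> s \<le> u"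
        using compact_attains_sup[of Z] by auto
      have small: "H s \<le> real n" if "s \<in> Z" for s
        using e(2)[of "d + \<tau> * s"] distd[of s] that \<sigma> by (auto simp: Z_def H_def \<delta>_def)
      have "u < x" using u(1) small[of x] big
        by (cases "u = x") (auto simp: Z_def H_def c_def)
      have offD: "bdd (d + \<tau> * s)" if "s \<in> {u<..x}" for s
      proof -
        have "s \<notin> Z" using u(2)[of s] that by auto
        then show ?thesis using in01[of s] that u(1) by (auto simp: Z_def D_def)
      qed
      have Hc: "continuous_on {u<..x} H"
        unfolding H_def
      proof (intro continuous_intros)
        have *: "continuous_on {t\<in>{0..1}. bdd t} h"
          unfolding continuous_on_eq_continuous_within
          by (intro ballI continuous_within_subset[OF cont_at]) auto
        show "continuous_on {u<..x} (\<lambda>s. h (d + \<tau> * s))"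
        proof (rule continuous_on_compose2[OF *])
          show "(\<lambda>s. d + \<tau> * s) ` {u<..x} \<subseteq> {t \<in> {0..1}. bdd t}"
            using offD in01 u(1) by (auto simp: Z_def)
        qed (intro continuous_intros)
      qed
      interpret R: injective_line "\<lambda>t. \<phi> (\<sigma> * t)"
        using \<sigma> reflect injective_line_axioms by auto
      have RH: "\<phi> (\<sigma> * H s) = g (d + \<tau> * s)" if "s \<in> {0..x}" for s
        using \<phi>h[OF in01[OF that]] \<sigma> by (auto simp: H_def)
      have gc: "continuous_on {0..x} (\<lambda>s. g (d + \<tau> * s))"
        by (rule continuous_on_compose2[OF g]) (auto intro!: continuous_intros simp: in01 image_subset_iff simp del: atLeastAtMost_iff)
      have u0: "u \<in> {0..x}" using u(1) by (auto simp: Z_def)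
      have lim: "((\<lambda>s. \<phi> (\<sigma> * H s)) \<longlongrightarrow> \<phi> (\<sigma> * H u)) (at_right u)"
      proof -
        have "((\<lambda>s. g (d + \<tau> * s)) \<longlongrightarrow> g (d + \<tau> * u)) (at u within {0..x})"
          using gc u0 by (auto simp: continuous_on)
        then have "((\<lambda>s. g (d + \<tau> * s)) \<longlongrightarrow> g (d + \<tau> * u)) (at u within {u<..x})"
          by (rule tendsto_within_subset) (use u0 in auto)
        moreover have "at u within {u<..x} = at_right u"
          by (rule at_within_nhd[of _ "{..<x}"]) (use \<open>u < x\<close> in auto)
        ultimately have "((\<lambda>s. g (d + \<tau> * s)) \<longlongrightarrow> \<phi> (\<sigma> * H u)) (at_right u)"
          using RH[OF u0] by simp
        moreover have "eventually (\<lambda>s. g (d + \<tau> * s) = \<phi> (\<sigma> * H s)) (at_right u)"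
          unfolding eventually_at_right_field
          using RH \<open>u < x\<close> u0 by (intro exI[of _ x]) auto
        ultimately show ?thesis by (rule Lim_transform_eventually)
      qed
      have level: "\<exists>s\<in>{u<..x}. H s = k" if "real n < k" "k \<le> c + 1" for k
        by (rule lift_meets_level[OF R.cont R.inj R.no_limit_top \<open>u < x\<close> Hc lim])
          (use small[OF u(1)] big that in \<open>auto simp: H_def\<close>)
      obtain s1 s2 where s: "s1 \<in> {u<..x}" "s2 \<in> {u<..x}" "H s1 = c" "H s2 = c + 1"
        using level[of c] level[of "c + 1"] by (auto simp: c_def)
      have near: "dist (\<phi> (\<sigma> * H s)) (g d) < \<rho>" if "s \<in> {u<..x}" for s
        using \<delta>0(2)[OF in01, of s] distd[of s] RH[of s] that u0 by (auto simp: \<delta>_def)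
      have "dist (\<phi> (\<sigma> * c)) (\<phi> (\<sigma> * (c + 1))) < 2 * \<rho>"
        using near[OF s(1)] near[OF s(2)] s
          dist_triangle2[of "\<phi> (\<sigma> * c)" "\<phi> (\<sigma> * (c + 1))" "g d"] by auto
      then show False using \<sigma> by (auto simp: \<rho>_def)
    qed
    have "bdd d"
      unfolding bdd_def
    proof (intro exI conjI ballI impI)
      show "\<delta> > 0" by fact
      fix s assume s: "s \<in> {0..1}" "dist s d < \<delta>"
      define \<tau> :: real where "\<tau> = (if s \<ge> d then 1 else - 1)"
      have \<tau>: "\<tau> \<in> {1, - 1}" "d + \<tau> * \<bar>s - d\<bar> = s" by (auto simp: \<tau>_def)
      have "1 * h s \<le> c + 1" "- 1 * h s \<le> c + 1"
        using bound[of 1 \<tau> "\<bar>s - d\<bar>"] bound[of "- 1" \<tau> "\<bar>s - d\<bar>"] \<tau> s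
        by (auto simp: dist_real_def simp del: insert_iff)
      then show "\<bar>h s\<bar> \<le> real (n + 2)" by (auto simp: c_def)
    qed
    then show False using d by (simp add: D_def)
  qed
  then have "bdd t" if "t \<in> {0..1}" for t using that by (auto simp: D_def)
  then show ?thesis
    using cont_at unfolding h_def[symmetric] continuous_on_eq_continuous_within by blast
qed

lemma openin_intrinsic_iff:
  "openin (intrinsic_topology (range \<phi>)) U \<longleftrightarrow> U \<subseteq> range \<phi> \<and> open (\<phi> -` U)"
proof (intro iffI conjI)
  assume U: "openin (intrinsic_topology (range \<phi>)) U"
  then show "U \<subseteq> range \<phi>" by (simp add: openin_intrinsic_topology)
  show "open (\<phi> -` U)"
    unfolding open_dist
  proof
    fix x assume x: "x \<in> \<phi> -` U"
    \<comment> \<open>The interval of radius 1 about \<open>x\<close>, run through as a path.\<close>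
    define g where "g s = \<phi> (x - 1 + 2 * s)" for s
    have "path g" unfolding path_def g_def
      by (intro continuous_on_compose2[OF cont] continuous_intros) auto
    moreover have "path_image g \<subseteq> range \<phi>" by (auto simp: path_image_def g_def)
    ultimately have "openin (top_of_set {0..1}) ({0..1} \<inter> g -` U)"
      using U by (simp add: openin_intrinsic_topology)
    moreover have "1 / 2 \<in> {0..1} \<inter> g -` U" using x by (simp add: g_def)
    ultimately obtain e where e: "e > 0" "\<And>s. s \<in> {0..1} \<Longrightarrow> dist s (1 / 2) < e \<Longrightarrow> g s \<in> U"
      unfolding openin_euclidean_subtopology_iff by force
    have "y \<in> \<phi> -` U" if "dist y x < min 1 (2 * e)" for y
      using e(2)[of "(y - x + 1) / 2"] that by (auto simp: g_def dist_real_def abs_less_iff field_simps)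
    then show "\<exists>e>0. \<forall>y. dist y x < e \<longrightarrow> y \<in> \<phi> -` U"
      using e(1) by (intro exI[of _ "min 1 (2 * e)"]) auto
  qed
next
  assume U: "U \<subseteq> range \<phi> \<and> open (\<phi> -` U)"
  show "openin (intrinsic_topology (range \<phi>)) U"
    unfolding openin_intrinsic_topology
  proof (intro conjI allI impI)
    show "U \<subseteq> range \<phi>" using U by simp
    fix g :: "real \<Rightarrow> 'a" assume "path g \<and> path_image g \<subseteq> range \<phi>"
    then have g: "continuous_on {0..1} g" "g ` {0..1} \<subseteq> range \<phi>"
      by (auto simp: path_def path_image_def)
    have "openin (top_of_set {0..1}) ({0..1} \<inter> (\<lambda>t. inv \<phi> (g t)) -` (\<phi> -` U))"
      using lift_continuous[OF g] U by (simp add: continuous_openin_preimage_gen)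
    moreover have "\<phi> (inv \<phi> (g t)) = g t" if "t \<in> {0..1}" for t
      using g(2) that by (simp add: f_inv_into_f image_subset_iff)
    then have "{0..1} \<inter> (\<lambda>t. inv \<phi> (g t)) -` (\<phi> -` U) = {0..1} \<inter> g -` U" by auto
    ultimately show "openin (top_of_set {0..1}) ({0..1} \<inter> g -` U)" by simp
  qed
qed

lemma homeomorphic_map_intrinsic:
  "homeomorphic_map euclideanreal (intrinsic_topology (range \<phi>)) \<phi>"
proof -
  have "topspace (intrinsic_topology (range \<phi>)) = range \<phi>"
  proof
    show "topspace (intrinsic_topology (range \<phi>)) \<subseteq> range \<phi>"
      using openin_intrinsic_iff[of "topspace (intrinsic_topology (range \<phi>))"] by simp
    have "openin (intrinsic_topology (range \<phi>)) (range \<phi>)"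
      unfolding openin_intrinsic_iff inj_vimage_image_eq[OF inj] by simp
    then show "range \<phi> \<subseteq> topspace (intrinsic_topology (range \<phi>))" by (rule openin_subset)
  qed
  moreover have "open_map euclideanreal (intrinsic_topology (range \<phi>)) \<phi>"
    unfolding open_map_def openin_intrinsic_iff
    by (auto simp: inj_vimage_image_eq[OF inj])
  moreover have "continuous_map euclideanreal (intrinsic_topology (range \<phi>)) \<phi>"
    unfolding continuous_map_def using calculation(1)
    by (auto simp: openin_intrinsic_iff simp flip: vimage_def)
  ultimately show ?thesis
    by (auto intro: bijective_open_imp_homeomorphic_map simp: inj)
qed

end

section \<open>Broken lines\<close>

text \<open>
  Polygonal lines are described by their germs: on each side of each parameter the curve is a
  straight segment, traversed at constant speed. This form is stable under piecewise affine maps.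
\<close>

locale broken_line = injective_line \<phi> for \<phi> :: "real \<Rightarrow> 'a::real_normed_vector" +
  assumes rays: "\<exists>e>0. \<exists>p q. \<forall>x\<in>{0..e}. \<phi> (t + x) = \<phi> t + x *\<^sub>R p \<and> \<phi> (t - x) = \<phi> t + x *\<^sub>R q"
begin

text \<open>
  Injectivity keeps the two segments at a corner from overlapping.
\<close>

lemma corner:
  obtains e p q where "e > 0"
    "\<And>x. 0 \<le> x \<Longrightarrow> x \<le> e \<Longrightarrow> \<phi> (t + x) = \<phi> t + x *\<^sub>R p"
    "\<And>x. 0 \<le> x \<Longrightarrow> x \<le> e \<Longrightarrow> \<phi> (t - x) = \<phi> t + x *\<^sub>R q"
    "p \<noteq> 0" "q \<noteq> 0" "\<And>x y. 0 < x \<Longrightarrow> 0 < y \<Longrightarrow> x *\<^sub>R p \<noteq> y *\<^sub>R q"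
proof -
  obtain e p q where e: "e > 0"
    and p: "\<And>x. 0 \<le> x \<Longrightarrow> x \<le> e \<Longrightarrow> \<phi> (t + x) = \<phi> t + x *\<^sub>R p"
    and q: "\<And>x. 0 \<le> x \<Longrightarrow> x \<le> e \<Longrightarrow> \<phi> (t - x) = \<phi> t + x *\<^sub>R q"
    using rays[of t] by (metis atLeastAtMost_iff)
  have "\<phi> (t + e) \<noteq> \<phi> t" "\<phi> (t - e) \<noteq> \<phi> t" using e by (auto simp: inj_eq[OF inj])
  then have "p \<noteq> 0" "q \<noteq> 0" using p[of e] q[of e] e by auto
  moreover have "x *\<^sub>R p \<noteq> y *\<^sub>R q" if "0 < x" "0 < y" for x y
  proof
    assume eq: "x *\<^sub>R p = y *\<^sub>R q"
    define c where "c = e / max x y"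
    have c: "c > 0" "c * x \<le> e" "c * y \<le> e"
      using e that by (auto simp: c_def field_simps max_def mult_left_mono)
    have "(c * x) *\<^sub>R p = (c * y) *\<^sub>R q"
      using eq by (metis scaleR_scaleR)
    then have "\<phi> (t + c * x) = \<phi> (t - c * y)"
      using p[of "c * x"] q[of "c * y"] c that by simp
    then have "c * x + c * y = 0" by (simp add: inj_eq[OF inj])
    moreover have "c * x > 0" "c * y > 0" using c that by simp_all
    ultimately show False by linarith
  qed
  ultimately show ?thesis using that[OF e p q] by blast
qed

text \<open>
  As soon as \<open>\<epsilon>\<close> is smaller than both segments at \<open>\<phi> t\<close>, the component of the line in the disc is
  cut off by the two parameters at which the segments reach distance \<open>\<epsilon>\<close>.
\<close>

lemma local_part_eq:
  assumes p: "\<And>x. 0 \<le> x \<Longrightarrow> x \<le> e \<Longrightarrow> \<phi> (t + x) = \<phi> t + x *\<^sub>R p" "p \<noteq> 0"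
    and q: "\<And>x. 0 \<le> x \<Longrightarrow> x \<le> e \<Longrightarrow> \<phi> (t - x) = \<phi> t + x *\<^sub>R q" "q \<noteq> 0"
    and \<epsilon>: "0 < \<epsilon>" "\<epsilon> \<le> e * norm p" "\<epsilon> \<le> e * norm q"
  shows "local_part (range \<phi>) (\<phi> t) \<epsilon> = \<phi> ` {t - \<epsilon> / norm q<..<t + \<epsilon> / norm p}"
proof -
  let ?I = "{t - \<epsilon> / norm q<..<t + \<epsilon> / norm p}"
  have np: "\<epsilon> / norm p > 0" "\<epsilon> / norm p \<le> e" and nq: "\<epsilon> / norm q > 0" "\<epsilon> / norm q \<le> e"
    using \<epsilon> p(2) q(2) by (simp_all add: field_simps)
  have sub: "\<phi> ` ?I \<subseteq> ball (\<phi> t) \<epsilon>"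
  proof
    fix z assume "z \<in> \<phi> ` ?I"
    then obtain y where y: "z = \<phi> y" "y \<in> ?I" by blast
    show "z \<in> ball (\<phi> t) \<epsilon>"
    proof (cases "y \<ge> t")
      case True
      then have "z = \<phi> t + (y - t) *\<^sub>R p" using p(1)[of "y - t"] y np by auto
      moreover have "(y - t) * norm p < \<epsilon>" using y p(2) by (auto simp: field_simps)
      ultimately show ?thesis using True by (simp add: dist_norm)
    next
      case False
      then have "z = \<phi> t + (t - y) *\<^sub>R q" using q(1)[of "t - y"] y nq by auto
      moreover have "(t - y) * norm q < \<epsilon>" using y q(2) by (auto simp: field_simps)
      ultimately show ?thesis using False by (simp add: dist_norm)
    qed
  qed
  have ends: "\<phi> (t + \<epsilon> / norm p) \<notin> ball (\<phi> t) \<epsilon>" "\<phi> (t - \<epsilon> / norm q) \<notin> ball (\<phi> t) \<epsilon>"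
    using p(1)[of "\<epsilon> / norm p"] q(1)[of "\<epsilon> / norm q"] np nq p(2) q(2) \<epsilon>
    by (auto simp: dist_norm)
  have conn: "connectedin (intrinsic_topology (range \<phi>)) (\<phi> ` J) \<longleftrightarrow> connected J" for J
    using homeomorphic_map_connectedness[OF homeomorphic_map_intrinsic, of J] by simp
  show ?thesis
    unfolding local_part_def
  proof (rule antisym)
    have "connectedin (subtopology (intrinsic_topology (range \<phi>)) (ball (\<phi> t) \<epsilon>)) (\<phi> ` ?I)"
      using sub conn[of ?I] by (simp add: connectedin_subtopology)
    then show "\<phi> ` ?I \<subseteq> connected_component_of_set
        (subtopology (intrinsic_topology (range \<phi>)) (ball (\<phi> t) \<epsilon>)) (\<phi> t)"
      by (rule connected_component_of_maximal) (use np nq in auto)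
    show "connected_component_of_set
        (subtopology (intrinsic_topology (range \<phi>)) (ball (\<phi> t) \<epsilon>)) (\<phi> t) \<subseteq> \<phi> ` ?I"
    proof
      fix z assume "z \<in> connected_component_of_set
        (subtopology (intrinsic_topology (range \<phi>)) (ball (\<phi> t) \<epsilon>)) (\<phi> t)"
      then obtain C where C: "connectedin (intrinsic_topology (range \<phi>)) C"
        "C \<subseteq> ball (\<phi> t) \<epsilon>" "\<phi> t \<in> C" "z \<in> C"
        by (auto simp: connected_component_of_def connectedin_subtopology)
      have "C \<subseteq> range \<phi>"
        using connectedin_subset_topspace[OF C(1)]
          homeomorphic_imp_surjective_map[OF homeomorphic_map_intrinsic] by simp
      then have CJ: "C = \<phi> ` (\<phi> -` C)" by auto
      define J where "J = \<phi> -` C"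
      have J: "connected J" "t \<in> J" "t + \<epsilon> / norm p \<notin> J" "t - \<epsilon> / norm q \<notin> J"
        using C conn[of J] CJ ends by (auto simp: J_def)
      have "J \<subseteq> ?I"
      proof
        fix y assume y: "y \<in> J"
        have "y < t + \<epsilon> / norm p"
        proof (rule ccontr)
          assume "\<not> ?thesis"
          then show False using connectedD_interval[OF J(1) J(2) y, of "t + \<epsilon> / norm p"] np J(3) by simp
        qed
        moreover have "t - \<epsilon> / norm q < y"
        proof (rule ccontr)
          assume "\<not> ?thesis"
          then show False using connectedD_interval[OF J(1) y J(2), of "t - \<epsilon> / norm q"] nq J(4) by simp
        qed
        ultimately show "y \<in> ?I" by simp
      qed
      then show "z \<in> \<phi> ` ?I" using C(4) CJ unfolding J_def by blast
    qed
  qed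
qed

end

lemma isolated_intersection_iff:
  assumes "injective_line \<phi>" "injective_line \<psi>" and T: "\<phi> t = T" "\<psi> s = T"
  shows "isolated_intersection (range \<phi>) (range \<psi>) T \<longleftrightarrow>
    (\<exists>\<delta>>0. \<phi> ` {t - \<delta><..<t + \<delta>} \<inter> \<psi> ` {s - \<delta><..<s + \<delta>} = {T})"
proof -
  interpret P: injective_line \<phi> by fact
  interpret Q: injective_line \<psi> by fact
  show ?thesis
  proof
    assume "isolated_intersection (range \<phi>) (range \<psi>) T"
    then obtain U V where UV: "open (\<phi> -` U)" "open (\<psi> -` V)" "U \<inter> V = {T}"
      unfolding isolated_intersection_def P.openin_intrinsic_iff Q.openin_intrinsic_iff by blast
    then have "t \<in> \<phi> -` U" "s \<in> \<psi> -` V" using T by auto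
    then obtain d1 d2 where d: "d1 > 0" "d2 > 0"
      "\<And>x. dist x t < d1 \<Longrightarrow> \<phi> x \<in> U" "\<And>x. dist x s < d2 \<Longrightarrow> \<psi> x \<in> V"
      using UV(1,2) unfolding open_dist by (metis vimageD)
    define \<delta> where "\<delta> = min d1 d2"
    have "\<phi> ` {t - \<delta><..<t + \<delta>} \<subseteq> U" "\<psi> ` {s - \<delta><..<s + \<delta>} \<subseteq> V"
      using d(3,4) by (auto simp: \<delta>_def dist_real_def)
    moreover have "\<delta> > 0" using d by (simp add: \<delta>_def)
    moreover have "T \<in> \<phi> ` {t - \<delta><..<t + \<delta>}" "T \<in> \<psi> ` {s - \<delta><..<s + \<delta>}"
      using imageI[of t "{t - \<delta><..<t + \<delta>}" \<phi>] imageI[of s "{s - \<delta><..<s + \<delta>}" \<psi>] T \<open>\<delta> > 0\<close> by simp_all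
    ultimately show "\<exists>\<delta>>0. \<phi> ` {t - \<delta><..<t + \<delta>} \<inter> \<psi> ` {s - \<delta><..<s + \<delta>} = {T}"
      using UV(3) by (intro exI[of _ \<delta>]) auto
  next
    assume "\<exists>\<delta>>0. \<phi> ` {t - \<delta><..<t + \<delta>} \<inter> \<psi> ` {s - \<delta><..<s + \<delta>} = {T}"
    then obtain \<delta> where \<delta>: "\<delta> > 0" "\<phi> ` {t - \<delta><..<t + \<delta>} \<inter> \<psi> ` {s - \<delta><..<s + \<delta>} = {T}"
      by blast
    have "openin (intrinsic_topology (range \<phi>)) (\<phi> ` {t - \<delta><..<t + \<delta>})"
      "openin (intrinsic_topology (range \<psi>)) (\<psi> ` {s - \<delta><..<s + \<delta>})"
      unfolding P.openin_intrinsic_iff Q.openin_intrinsic_iff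
      by (auto simp: inj_vimage_image_eq[OF P.inj] inj_vimage_image_eq[OF Q.inj])
    then show "isolated_intersection (range \<phi>) (range \<psi>) T"
      using \<delta>(2) unfolding isolated_intersection_def by blast
  qed
qed

text \<open>
  Near \<open>T\<close> both lines are star-shaped about \<open>T\<close>, so every further common point \<open>z\<close> close to \<open>T\<close>
  brings the whole segment from \<open>T\<close> to \<open>z\<close> with it.
\<close>

lemma not_isolated_imp_segment:
  assumes "broken_line \<phi>" "broken_line \<psi>" and T: "\<phi> t = T" "\<psi> s = T"
    and "\<not> isolated_intersection (range \<phi>) (range \<psi>) T"
  shows "intersect_along_segment (range \<phi>) (range \<psi>) T"
proof -
  interpret P: broken_line \<phi> by fact
  interpret Q: broken_line \<psi> by fact
  have side: "\<exists>\<delta>>0. \<forall>z\<in>\<gamma> ` {u - \<delta><..<u + \<delta>}. closed_segment (\<gamma> u) z \<subseteq> range \<gamma>"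
    if "broken_line \<gamma>" for \<gamma> :: "real \<Rightarrow> 'a" and u
  proof -
    interpret C: broken_line \<gamma> by fact
    obtain e p q where e: "e > 0"
      "\<And>x. 0 \<le> x \<Longrightarrow> x \<le> e \<Longrightarrow> \<gamma> (u + x) = \<gamma> u + x *\<^sub>R p"
      "\<And>x. 0 \<le> x \<Longrightarrow> x \<le> e \<Longrightarrow> \<gamma> (u - x) = \<gamma> u + x *\<^sub>R q"
      using C.corner[of u] by metis
    have "closed_segment (\<gamma> u) (\<gamma> y) \<subseteq> range \<gamma>" if y: "y \<in> {u - e<..<u + e}" for y
    proof
      fix z assume "z \<in> closed_segment (\<gamma> u) (\<gamma> y)"
      then obtain k where k: "0 \<le> k" "k \<le> 1" "z = (1 - k) *\<^sub>R \<gamma> u + k *\<^sub>R \<gamma> y"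
        by (auto simp: in_segment)
      then have z: "z = \<gamma> u + k *\<^sub>R (\<gamma> y - \<gamma> u)" by (simp add: algebra_simps)
      have kx: "0 \<le> k * x \<and> k * x \<le> e" if "0 \<le> x" "x < e" for x
        using k that mult_left_le_one_le[of x k] by auto
      show "z \<in> range \<gamma>"
      proof (cases "y \<ge> u")
        case True
        then have "z = \<gamma> (u + k * (y - u))"
          using e(2)[of "y - u"] e(2)[of "k * (y - u)"] kx[of "y - u"] y z by auto
        then show ?thesis by blast
      next
        case False
        then have "z = \<gamma> (u - k * (u - y))"
          using e(3)[of "u - y"] e(3)[of "k * (u - y)"] kx[of "u - y"] y z by auto
        then show ?thesis by blast
      qed
    qed
    then show ?thesis using e(1) by blast
  qed
  obtain d1 d2 where d: "d1 > 0" "d2 > 0"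
    "\<And>z. z \<in> \<phi> ` {t - d1<..<t + d1} \<Longrightarrow> closed_segment T z \<subseteq> range \<phi>"
    "\<And>z. z \<in> \<psi> ` {s - d2<..<s + d2} \<Longrightarrow> closed_segment T z \<subseteq> range \<psi>"
    using side[OF assms(1), of t] side[OF assms(2), of s] T by metis
  define \<delta> where "\<delta> = min d1 d2"
  have "\<delta> > 0" using d by (simp add: \<delta>_def)
  then have "\<phi> ` {t - \<delta><..<t + \<delta>} \<inter> \<psi> ` {s - \<delta><..<s + \<delta>} \<noteq> {T}"
    using assms(5) isolated_intersection_iff[OF P.injective_line_axioms Q.injective_line_axioms T]
    by blast
  moreover have "T \<in> \<phi> ` {t - \<delta><..<t + \<delta>}" "T \<in> \<psi> ` {s - \<delta><..<s + \<delta>}"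
    using imageI[of t "{t - \<delta><..<t + \<delta>}" \<phi>] imageI[of s "{s - \<delta><..<s + \<delta>}" \<psi>] T \<open>\<delta> > 0\<close> by simp_all
  ultimately obtain z where z: "z \<noteq> T" "z \<in> \<phi> ` {t - \<delta><..<t + \<delta>}" "z \<in> \<psi> ` {s - \<delta><..<s + \<delta>}"
    by blast
  have "closed_segment T z \<subseteq> range \<phi> \<inter> range \<psi>"
  proof -
    have "\<phi> ` {t - \<delta><..<t + \<delta>} \<subseteq> \<phi> ` {t - d1<..<t + d1}"
      "\<psi> ` {s - \<delta><..<s + \<delta>} \<subseteq> \<psi> ` {s - d2<..<s + d2}"
      by (auto simp: \<delta>_def intro!: image_mono)
    then show ?thesis using d(3)[of z] d(4)[of z] z(2,3) by blast
  qed
  then show ?thesis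
    unfolding intersect_along_segment_def using z(1)
    by (intro exI[of _ "linepath T z"]) auto
qed

section \<open>A disc cut along two radii\<close>

definition cross :: "real \<times> real \<Rightarrow> real \<times> real \<Rightarrow> real" where
  "cross u v = fst u * snd v - snd u * fst v"

lemma cross_simps [simp]:
  "cross u u = 0" "cross 0 v = 0" "cross u 0 = 0"
  "cross (- u) v = - cross u v" "cross u (- v) = - cross u v"
  "cross (x *\<^sub>R u) v = x * cross u v" "cross u (x *\<^sub>R v) = x * cross u v"
  by (simp_all add: cross_def algebra_simps)

lemma cross_distrib:
  "cross (u + u') v = cross u v + cross u' v" "cross u (v + v') = cross u v + cross u v'"
  "cross (u - u') v = cross u v - cross u' v" "cross u (v - v') = cross u v - cross u v'"
  by (simp_all add: cross_def algebra_simps)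

lemma cross_skew: "cross v u = - cross u v"
  by (simp add: cross_def)

lemma continuous_on_cross [continuous_intros]:
  "continuous_on S f \<Longrightarrow> continuous_on S g \<Longrightarrow> continuous_on S (\<lambda>z. cross (f z) (g z))"
  unfolding cross_def by (intro continuous_intros)

lemma tendsto_cross [tendsto_intros]:
  "(f \<longlongrightarrow> a) F \<Longrightarrow> (g \<longlongrightarrow> b) F \<Longrightarrow> ((\<lambda>z. cross (f z) (g z)) \<longlongrightarrow> cross a b) F"
  unfolding cross_def by (intro tendsto_intros)

text \<open>
  Cramer's rule in the plane.
\<close>
lemma cross_expand: "cross p q *\<^sub>R z = cross z q *\<^sub>R p + cross p z *\<^sub>R q"
  by (simp add: cross_def prod_eq_iff algebra_simps)

lemma cross_zero_parallel: "cross p z = 0 \<Longrightarrow> p \<noteq> 0 \<Longrightarrow> \<exists>x. z = x *\<^sub>R p"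
proof -
  assume a: "cross p z = 0" "p \<noteq> 0"
  show ?thesis
  proof (cases "fst p = 0")
    case True
    then have "snd p \<noteq> 0" "fst z = 0" using a by (auto simp: cross_def prod_eq_iff)
    then have "z = (snd z / snd p) *\<^sub>R p" using True by (simp add: prod_eq_iff)
    then show ?thesis by blast
  next
    case False
    have "fst p * snd z = snd p * fst z" using a(1) by (simp add: cross_def)
    then have "z = (fst z / fst p) *\<^sub>R p" using False by (simp add: prod_eq_iff eq_divide_eq mult.commute)
    then show ?thesis by blast
  qed
qed

lemma card_components_two:
  fixes A B :: "'a::real_normed_vector set"
  assumes "open A" "open B" "connected A" "connected B" "A \<noteq> {}" "B \<noteq> {}" "A \<inter> B = {}"
  shows "card (components (A \<union> B)) = 2"
proof -
  have "components (A \<union> B) = {A, B}"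
  proof (rule components_open_unique)
    show "pairwise disjnt {A, B}"
      using assms(7) by (simp add: pairwise_insert disjnt_def Int_commute)
  qed (use assms(1-6) in auto)
  moreover have "A \<noteq> B" using assms(5,7) by (metis Int_absorb)
  ultimately show ?thesis by simp
qed

text \<open>
  The convex pieces from which all the sectors below are put together.
\<close>

lemma half_disc:
  fixes c :: "real \<times> real"
  shows "convex {z \<in> ball T \<epsilon>. cross c (z - T) > 0}" "open {z \<in> ball T \<epsilon>. cross c (z - T) > 0}"
    "\<epsilon> > 0 \<Longrightarrow> c \<noteq> 0 \<Longrightarrow> {z \<in> ball T \<epsilon>. cross c (z - T) > 0} \<noteq> {}"
proof -
  have eq: "{z. cross c (z - T) > 0} = {z. (- snd c, fst c) \<bullet> z > (- snd c, fst c) \<bullet> T}"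
    by (intro Collect_cong) (simp add: cross_def inner_prod_def right_diff_distrib, linarith)
  have *: "{z \<in> ball T \<epsilon>. cross c (z - T) > 0} = ball T \<epsilon> \<inter> {z. cross c (z - T) > 0}" by auto
  show "convex {z \<in> ball T \<epsilon>. cross c (z - T) > 0}"
    unfolding * eq by (intro convex_Int convex_ball convex_halfspace_gt)
  show "open {z \<in> ball T \<epsilon>. cross c (z - T) > 0}"
    unfolding * eq by (intro open_Int open_ball open_halfspace_gt)
  assume \<epsilon>: "\<epsilon> > 0" "c \<noteq> 0"
  define n where "n = (- snd c, fst c)"
  have "cross c n = (fst c)\<^sup>2 + (snd c)\<^sup>2"
    by (simp add: n_def cross_def power2_eq_square)
  then have n: "n \<noteq> 0" "cross c n > 0"
    using \<epsilon>(2) by (auto simp: n_def prod_eq_iff sum_power2_gt_zero_iff)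
  then have "T + (\<epsilon> / 2 / norm n) *\<^sub>R n \<in> {z \<in> ball T \<epsilon>. cross c (z - T) > 0}"
    using \<epsilon> by (simp add: dist_norm)
  then show "{z \<in> ball T \<epsilon>. cross c (z - T) > 0} \<noteq> {}" by blast
qed

text \<open>
  If the radii are not opposite, one sector is the intersection and the other one the union of two
  overlapping half discs bounded by their lines; if they are opposite, the sectors are half discs.
\<close>

lemma card_components_ball_minus_two_radii:
  fixes p q :: "real \<times> real"
  assumes \<epsilon>: "\<epsilon> > 0" and pq: "p \<noteq> 0" "q \<noteq> 0" "\<And>x y. 0 < x \<Longrightarrow> 0 < y \<Longrightarrow> x *\<^sub>R p \<noteq> y *\<^sub>R q"
    and R: "\<And>z. z \<in> ball T \<epsilon> \<Longrightarrow> z \<in> R \<longleftrightarrow> (\<exists>x\<ge>0. z = T + x *\<^sub>R p \<or> z = T + x *\<^sub>R q)"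
  shows "card (components (ball T \<epsilon> - R)) = 2"
proof -
  have wedge: "card (components (ball T \<epsilon> - R)) = 2"
    if c: "cross p q > 0" and pq: "p \<noteq> 0" "q \<noteq> 0"
    and R: "\<And>z. z \<in> ball T \<epsilon> \<Longrightarrow> z \<in> R \<longleftrightarrow> (\<exists>x\<ge>0. z = T + x *\<^sub>R p \<or> z = T + x *\<^sub>R q)" for p q
  proof -
    define A where "A = {z \<in> ball T \<epsilon>. cross p (z - T) > 0} \<inter> {z \<in> ball T \<epsilon>. cross (- q) (z - T) > 0}"
    define B1 where "B1 = {z \<in> ball T \<epsilon>. cross (- p) (z - T) > 0}"
    define B2 where "B2 = {z \<in> ball T \<epsilon>. cross q (z - T) > 0}"
    define k where "k = \<epsilon> / 2 / norm (p + q)"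
    have npq: "p + q \<noteq> 0"
    proof
      assume "p + q = 0"
      then have "q = - p" by (simp add: eq_neg_iff_add_eq_0 add.commute)
      then show False using c by simp
    qed
    have k: "k > 0" "T + k *\<^sub>R (p + q) \<in> ball T \<epsilon>" "T + (- k) *\<^sub>R (p + q) \<in> ball T \<epsilon>"
      using \<epsilon> npq by (auto simp: k_def dist_norm)
    have "cross p (k *\<^sub>R (p + q)) = k * cross p q" "cross q (k *\<^sub>R (p + q)) = - (k * cross p q)"
      "k * cross p q > 0"
      using c k(1) cross_skew[of q p] by (simp_all add: cross_distrib)
    then have mem: "T + k *\<^sub>R (p + q) \<in> A" "T + (- k) *\<^sub>R (p + q) \<in> B1 \<inter> B2"
      unfolding A_def B1_def B2_def using k(2,3)
      by (simp_all add: cross_distrib)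
    have "ball T \<epsilon> - R = A \<union> (B1 \<union> B2)"
    proof (intro set_eqI iffI)
      fix z assume z: "z \<in> ball T \<epsilon> - R"
      show "z \<in> A \<union> (B1 \<union> B2)"
      proof (rule ccontr)
        assume n: "z \<notin> A \<union> (B1 \<union> B2)"
        define x y where "x = cross (z - T) q / cross p q" and "y = cross p (z - T) / cross p q"
        have "z - T = (1 / cross p q) *\<^sub>R (cross p q *\<^sub>R (z - T))" using c by simp
        also have "\<dots> = (1 / cross p q) *\<^sub>R (cross (z - T) q *\<^sub>R p + cross p (z - T) *\<^sub>R q)"
          by (rule arg_cong[OF cross_expand])
        also have "\<dots> = x *\<^sub>R p + y *\<^sub>R q"
          by (simp add: x_def y_def scaleR_add_right)
        finally have "z = T + (x *\<^sub>R p + y *\<^sub>R q)" by (simp add: algebra_simps)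
        moreover have "x \<ge> 0" "y \<ge> 0" "x = 0 \<or> y = 0"
        proof -
          have "cross p (z - T) \<ge> 0" "cross q (z - T) \<le> 0" "cross p (z - T) = 0 \<or> cross q (z - T) = 0"
            using n z by (auto simp: A_def B1_def B2_def not_less)
          then show "x \<ge> 0" "y \<ge> 0" "x = 0 \<or> y = 0"
            using c cross_skew[of q "z - T"] by (auto simp: x_def y_def divide_le_0_iff)
        qed
        ultimately show False using z R[of z] by auto
      qed
    next
      fix z assume z: "z \<in> A \<union> (B1 \<union> B2)"
      then have "z \<in> ball T \<epsilon>" by (auto simp: A_def B1_def B2_def)
      moreover have "z \<notin> R"
      proof
        assume "z \<in> R"
        then obtain x where x: "x \<ge> 0" "z - T = x *\<^sub>R p \<or> z - T = x *\<^sub>R q"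
          using R[OF calculation] by auto
        have "cross p (z - T) \<ge> 0" "cross q (z - T) \<le> 0" "cross p (z - T) = 0 \<or> cross q (z - T) = 0"
          using x c cross_skew[of q p] by (auto simp: mult_nonneg_nonpos)
        then show False
          using z by (auto simp: A_def B1_def B2_def )
      qed
      ultimately show "z \<in> ball T \<epsilon> - R" by simp
    qed
    moreover have "card (components (A \<union> (B1 \<union> B2))) = 2"
    proof (rule card_components_two)
      show "open A" unfolding A_def by (intro open_Int half_disc)
      show "open (B1 \<union> B2)" unfolding B1_def B2_def by (intro open_Un half_disc)
      show "connected A" unfolding A_def by (intro convex_connected convex_Int half_disc)
      show "connected (B1 \<union> B2)"
      proof (rule connected_Un)
        show "connected B1" unfolding B1_def by (intro convex_connected half_disc)
        show "connected B2" unfolding B2_def by (intro convex_connected half_disc)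
        show "B1 \<inter> B2 \<noteq> {}" using mem by blast
      qed
      show "A \<inter> (B1 \<union> B2) = {}" by (auto simp: A_def B1_def B2_def )
    qed (use mem in auto)
    ultimately show ?thesis by simp
  qed
  consider "cross p q > 0" | "cross q p > 0" | "cross p q = 0" using cross_skew[of p q] by linarith
  then show ?thesis
  proof cases
    case 1
    then show ?thesis using wedge[of p q] pq R by blast
  next
    case 2
    then show ?thesis using wedge[of q p] pq R by blast
  next
    case 3
    then obtain c where c: "q = c *\<^sub>R p" using cross_zero_parallel pq by blast
    have "c < 0" using pq(2) pq(3)[of c 1] c by (cases c "0 :: real" rule: linorder_cases) auto
    define A where "A = {z \<in> ball T \<epsilon>. cross p (z - T) > 0}"
    define B where "B = {z \<in> ball T \<epsilon>. cross (- p) (z - T) > 0}"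
    have "ball T \<epsilon> - R = A \<union> B"
    proof (intro set_eqI iffI)
      fix z assume z: "z \<in> ball T \<epsilon> - R"
      show "z \<in> A \<union> B"
      proof (rule ccontr)
        assume "z \<notin> A \<union> B"
        then have "cross p (z - T) = 0" using z by (auto simp: A_def B_def )
        then obtain x where x: "z - T = x *\<^sub>R p" using cross_zero_parallel pq by blast
        have "z = T + (z - T)" by simp
        then have "z = T + x *\<^sub>R p" "z = T + (x / c) *\<^sub>R q" using \<open>c < 0\<close> c x by simp_all
        moreover have "x \<ge> 0 \<or> x / c \<ge> 0" using \<open>c < 0\<close> by (auto simp: field_simps)
        ultimately show False using z R[of z] by blast
      qed
    next
      fix z assume "z \<in> A \<union> B"
      then show "z \<in> ball T \<epsilon> - R" 
        using R[of z] c
        by (auto simp: A_def B_def)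
    qed
    moreover have "card (components (A \<union> B)) = 2"
    proof (rule card_components_two)
      show "open A" "open B" unfolding A_def B_def by (simp_all only: half_disc(2))
      show "connected A" unfolding A_def by (intro convex_connected half_disc)
      show "connected B" unfolding B_def by (intro convex_connected half_disc)
      show "A \<noteq> {}" "B \<noteq> {}" unfolding A_def B_def 
        using half_disc(3)[OF \<epsilon>, of p T] half_disc(3)[OF \<epsilon>, of "- p" T] pq(1) by simp_all
      show "A \<inter> B = {}" by (auto simp: A_def B_def)
    qed
    ultimately show ?thesis by simp
  qed
qed

section \<open>Tangency from one-sidedness\<close>

text \<open>
  Topological one-sidedness suffices for a tangential intersection: if the points of \<open>\<psi>\<close> close to but
  different from \<open>T\<close> are joined by a connected set \<open>B\<close> that avoids \<open>\<phi>\<close> near \<open>T\<close>, they lie in one component of the cut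
  disc, and so do the two radii of \<open>\<psi>\<close>, which start in \<open>B\<close> and meet \<open>\<phi>\<close> only in \<open>T\<close>. The sets \<open>B\<close>
  will be homeomorphic images of half discs.
\<close>

lemma one_sided_imp_tangential:
  fixes \<phi> \<psi> :: "real \<Rightarrow> real \<times> real"
  assumes "broken_line \<phi>" "broken_line \<psi>" and T: "\<phi> t = T" "\<psi> s = T"
    and \<delta>: "\<delta> > 0" "\<phi> ` {t - \<delta><..<t + \<delta>} \<inter> \<psi> ` {s - \<delta><..<s + \<delta>} = {T}"
    and side: "\<And>\<epsilon>. \<epsilon> > 0 \<Longrightarrow> \<exists>B \<eta>. connected B \<and> B \<subseteq> ball T \<epsilon> \<and> B \<inter> \<phi> ` {t - \<delta><..<t + \<delta>} = {} \<and>
        \<eta> > 0 \<and> (\<forall>x. 0 < \<bar>x - s\<bar> \<and> \<bar>x - s\<bar> < \<eta> \<longrightarrow> \<psi> x \<in> B)"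
  shows "tangential_intersection (range \<phi>) (range \<psi>) T"
proof -
  interpret P: broken_line \<phi> by fact
  interpret Q: broken_line \<psi> by fact
  obtain e p q where e: "e > 0"
    and p: "\<And>x. 0 \<le> x \<Longrightarrow> x \<le> e \<Longrightarrow> \<phi> (t + x) = \<phi> t + x *\<^sub>R p" "p \<noteq> 0"
    and q: "\<And>x. 0 \<le> x \<Longrightarrow> x \<le> e \<Longrightarrow> \<phi> (t - x) = \<phi> t + x *\<^sub>R q" "q \<noteq> 0"
    and pq: "\<And>x y. 0 < x \<Longrightarrow> 0 < y \<Longrightarrow> x *\<^sub>R p \<noteq> y *\<^sub>R q"
    using P.corner[of t] by metis
  obtain e' p' q' where e': "e' > 0"
    and p': "\<And>x. 0 \<le> x \<Longrightarrow> x \<le> e' \<Longrightarrow> \<psi> (s + x) = \<psi> s + x *\<^sub>R p'" "p' \<noteq> 0"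
    and q': "\<And>x. 0 \<le> x \<Longrightarrow> x \<le> e' \<Longrightarrow> \<psi> (s - x) = \<psi> s + x *\<^sub>R q'" "q' \<noteq> 0"
    using Q.corner[of s] by metis
  define m where "m = min (min (norm p) (norm q)) (min (norm p') (norm q'))"
  \<comment> \<open>Small enough that the parts of both lines in the disc are two radii with parameters within \<open>\<delta>\<close>.\<close>
  define \<epsilon> where "\<epsilon> = min \<delta> (min e e') * m"
  have m: "m > 0" "m \<le> norm p" "m \<le> norm q" "m \<le> norm p'" "m \<le> norm q'"
    using p q p' q' by (auto simp: m_def)
  have \<epsilon>: "\<epsilon> > 0" using m e e' \<delta> by (simp add: \<epsilon>_def)
  have le: "\<epsilon> \<le> x * n" if "min \<delta> (min e e') \<le> x" "m \<le> n" for x n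
    unfolding \<epsilon>_def using that m e e' \<delta> by (intro mult_mono) auto
  have leD: "\<epsilon> / n \<le> \<delta>" if "m \<le> n" for n
    using le[of \<delta> n] that m(1) by (simp add: field_simps)
  define L where "L = local_part (range \<phi>) T \<epsilon>"
  define M where "M = local_part (range \<psi>) T \<epsilon>"
  have L: "L = \<phi> ` {t - \<epsilon> / norm q<..<t + \<epsilon> / norm p}"
    unfolding L_def T(1)[symmetric] using \<epsilon> m by (intro P.local_part_eq[OF p q] le) auto
  have M: "M = \<psi> ` {s - \<epsilon> / norm q'<..<s + \<epsilon> / norm p'}"
    unfolding M_def T(2)[symmetric] using \<epsilon> m by (intro Q.local_part_eq[OF p' q'] le) auto
  have Lsub: "L \<subseteq> \<phi> ` {t - \<delta><..<t + \<delta>}"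
    unfolding L using leD[of "norm p"] leD[of "norm q"] m by (intro image_mono) auto
  have Msub: "M \<subseteq> \<psi> ` {s - \<delta><..<s + \<delta>}"
    unfolding M using leD[of "norm p'"] leD[of "norm q'"] m by (intro image_mono) auto
  have Mball: "M \<subseteq> ball T \<epsilon>"
    unfolding M_def local_part_def using connected_component_of_subset_topspace by fastforce
  have card2: "card (components (ball T \<epsilon> - L)) = 2"
  proof (rule card_components_ball_minus_two_radii[OF \<epsilon> p(2) q(2) pq])
    fix z assume z: "z \<in> ball T \<epsilon>"
    have "\<epsilon> / norm p \<le> e" "\<epsilon> / norm q \<le> e"
      using le[of e "norm p"] le[of e "norm q"] m p(2) q(2) by (simp_all add: pos_divide_le_eq)
    show "z \<in> L \<longleftrightarrow> (\<exists>x\<ge>0. z = T + x *\<^sub>R p \<or> z = T + x *\<^sub>R q)"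
    proof
      assume "z \<in> L"
      then obtain y where y: "z = \<phi> y" "t - \<epsilon> / norm q < y" "y < t + \<epsilon> / norm p" by (auto simp: L)
      show "\<exists>x\<ge>0. z = T + x *\<^sub>R p \<or> z = T + x *\<^sub>R q"
      proof (cases "y \<ge> t")
        case True
        then show ?thesis using p(1)[of "y - t"] y T \<open>\<epsilon> / norm p \<le> e\<close> by (intro exI[of _ "y - t"]) auto
      next
        case False
        then show ?thesis using q(1)[of "t - y"] y T \<open>\<epsilon> / norm q \<le> e\<close> by (intro exI[of _ "t - y"]) auto
      qed
    next
      assume "\<exists>x\<ge>0. z = T + x *\<^sub>R p \<or> z = T + x *\<^sub>R q"
      then obtain x where x: "x \<ge> 0" "z = T + x *\<^sub>R p \<or> z = T + x *\<^sub>R q" by blast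
      from x(2) show "z \<in> L"
      proof
        assume zz: "z = T + x *\<^sub>R p"
        then have "x < \<epsilon> / norm p" using z x(1) p(2) by (simp add: dist_norm field_simps)
        moreover have "z = \<phi> (t + x)" using p(1)[of x] x(1) zz T calculation \<open>\<epsilon> / norm p \<le> e\<close> by simp
        moreover have "\<epsilon> / norm q > 0" using \<epsilon> q(2) by simp
        ultimately show "z \<in> L" unfolding L using x(1) by (intro image_eqI[of _ _ "t + x"]) auto
      next
        assume zz: "z = T + x *\<^sub>R q"
        then have "x < \<epsilon> / norm q" using z x(1) q(2) by (simp add: dist_norm field_simps)
        moreover have "z = \<phi> (t - x)" using q(1)[of x] x(1) zz T calculation \<open>\<epsilon> / norm q \<le> e\<close> by simp
        moreover have "\<epsilon> / norm p > 0" using \<epsilon> p(2) by simp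
        ultimately show "z \<in> L" unfolding L using x(1) by (intro image_eqI[of _ _ "t - x"]) auto
      qed
    qed
  qed
  obtain B \<eta> where B: "connected B" "B \<subseteq> ball T \<epsilon>" "B \<inter> \<phi> ` {t - \<delta><..<t + \<delta>} = {}" "\<eta> > 0"
    "\<And>x. 0 < \<bar>x - s\<bar> \<Longrightarrow> \<bar>x - s\<bar> < \<eta> \<Longrightarrow> \<psi> x \<in> B"
    using side[OF \<epsilon>] by metis
  have BL: "B \<subseteq> ball T \<epsilon> - L" using B(2,3) Lsub by blast
  have Bne: "\<psi> (s + \<eta> / 2) \<in> B" using B(4) B(5)[of "s + \<eta> / 2"] by simp
  define C where "C = connected_component_set (ball T \<epsilon> - L) (\<psi> (s + \<eta> / 2))"
  have C: "C \<in> components (ball T \<epsilon> - L)" unfolding C_def using BL Bne by (auto simp: components_def)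
  have BC: "B \<subseteq> C" unfolding C_def using B(1) BL Bne by (intro connected_component_maximal)
  have MT: "M - {T} \<subseteq> ball T \<epsilon> - L"
    using Mball Msub Lsub \<delta>(2) by blast
  have piece: "\<psi> ` J \<subseteq> C" if "connected J" "\<psi> ` J \<subseteq> M - {T}" "x \<in> J" "0 < \<bar>x - s\<bar>" "\<bar>x - s\<bar> < \<eta>" for J x
  proof (rule components_maximal[OF C])
    show "connected (\<psi> ` J)"
      by (rule connected_continuous_image[OF continuous_on_subset[OF Q.cont] that(1)]) simp
    show "\<psi> ` J \<subseteq> ball T \<epsilon> - L" using that(2) MT by blast
    show "C \<inter> \<psi> ` J \<noteq> {}" using B(5)[OF that(4,5)] BC that(3) by blast
  qed
  have pos: "\<epsilon> / norm p' > 0" "\<epsilon> / norm q' > 0" using \<epsilon> p' q' by simp_all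
  have half: "0 < min \<eta> k / 2" "min \<eta> k / 2 < \<eta>" "min \<eta> k / 2 < k" if "k > 0" for k
    using that B(4) by (auto simp: min_def)
  have noT: "T \<notin> \<psi> ` J" if "s \<notin> J" for J
    using that T(2) inj_image_mem_iff[OF Q.inj] by metis
  have r: "\<psi> ` {s<..<s + \<epsilon> / norm p'} \<subseteq> C"
  proof (rule piece)
    have "\<psi> ` {s<..<s + \<epsilon> / norm p'} \<subseteq> M" unfolding M using pos by (intro image_mono) auto
    then show "\<psi> ` {s<..<s + \<epsilon> / norm p'} \<subseteq> M - {T}" using noT[of "{s<..<s + \<epsilon> / norm p'}"] by auto
    show "s + min \<eta> (\<epsilon> / norm p') / 2 \<in> {s<..<s + \<epsilon> / norm p'}" using half[OF pos(1)] by simp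
  qed (use half[OF pos(1)] in \<open>simp_all del: min_less_iff_conj\<close>)
  have l: "\<psi> ` {s - \<epsilon> / norm q'<..<s} \<subseteq> C"
  proof (rule piece)
    have "\<psi> ` {s - \<epsilon> / norm q'<..<s} \<subseteq> M" unfolding M using pos by (intro image_mono) auto
    then show "\<psi> ` {s - \<epsilon> / norm q'<..<s} \<subseteq> M - {T}" using noT[of "{s - \<epsilon> / norm q'<..<s}"] by auto
    show "s - min \<eta> (\<epsilon> / norm q') / 2 \<in> {s - \<epsilon> / norm q'<..<s}" using half[OF pos(2)] by simp
  qed (use half[OF pos(2)] in \<open>simp_all del: min_less_iff_conj\<close>)
  have "M - {T} \<subseteq> C"
  proof
    fix z assume "z \<in> M - {T}"
    then obtain y where y: "z = \<psi> y" "s - \<epsilon> / norm q' < y" "y < s + \<epsilon> / norm p'" "\<psi> y \<noteq> T"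
      by (auto simp: M)
    moreover have "y \<noteq> s" using y(4) T(2) by blast
    ultimately show "z \<in> C" using r l by (cases "y < s") auto
  qed
  moreover have "isolated_intersection (range \<phi>) (range \<psi>) T"
    using \<delta> isolated_intersection_iff[OF P.injective_line_axioms Q.injective_line_axioms T] by blast
  ultimately show ?thesis
    unfolding tangential_intersection_def using \<epsilon> card2 C unfolding L_def M_def by blast
qed

section \<open>The expanding line of a planar saddle\<close>

text \<open>
  A planar homeomorphism \<open>F\<close> that maps segments piecewise affinely and is linear with eigenvalues
  \<open>\<mu>\<close> (expanding) and \<open>\<nu>\<close> near its fixed point \<open>X\<close>. Stable manifolds arise by exchanging \<open>F\<close> and \<open>G\<close>.
  For the Lozi map the determinant is negative, which makes the signs of \<open>\<mu>\<close> and \<open>\<nu>\<close> opposite.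
\<close>

locale saddle =
  fixes F G :: "real \<times> real \<Rightarrow> real \<times> real" and X v w :: "real \<times> real" and \<mu> \<nu> r :: real
  assumes cont_F: "continuous_on UNIV F" and cont_G: "continuous_on UNIV G"
    and GF: "G (F z) = z" and FG: "F (G z) = z"
    and rays_F: "\<exists>e>0. \<exists>q. \<forall>x\<in>{0..e}. F (z + x *\<^sub>R p) = F z + x *\<^sub>R q"
    and linear: "\<bar>t\<bar> \<le> r \<Longrightarrow> \<bar>s\<bar> \<le> r \<Longrightarrow>
      F (X + t *\<^sub>R v + s *\<^sub>R w) = X + (\<mu> * t) *\<^sub>R v + (\<nu> * s) *\<^sub>R w"
    and r_pos: "r > 0" and mu: "1 < \<bar>\<mu>\<bar>" and nu: "\<bar>\<nu>\<bar> < 1" and mu_nu: "\<mu> * \<nu> < 0"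
    and indep: "cross v w \<noteq> 0"
begin

lemma FX: "F X = X"
  using linear[of 0 0] r_pos by simp

lemma inv_iter: "(G ^^ n) ((F ^^ n) z) = z"
  by (induction n arbitrary: z) (simp_all add: funpow_swap1 GF)

lemma iter_inv: "(F ^^ n) ((G ^^ n) z) = z"
  by (induction n arbitrary: z) (simp_all add: funpow_swap1 FG)

lemma cont_iter: "continuous_on UNIV (F ^^ n)"
proof (induction n)
  case (Suc n)
  then show ?case
    using continuous_on_compose[OF Suc.IH continuous_on_subset[OF cont_F]] by simp
qed (simp add: id_def)

lemma rays_iter: "\<exists>e>0. \<exists>q. \<forall>x\<in>{0..e}. (F ^^ n) (z + x *\<^sub>R p) = (F ^^ n) z + x *\<^sub>R q"
proof (induction n)
  case 0
  show ?case by (intro exI[of _ 1]) auto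
next
  case (Suc n)
  then obtain e q where e: "e > 0" "\<And>x. x \<in> {0..e} \<Longrightarrow> (F ^^ n) (z + x *\<^sub>R p) = (F ^^ n) z + x *\<^sub>R q"
    by blast
  obtain e' q' where e': "e' > 0"
    "\<And>x. x \<in> {0..e'} \<Longrightarrow> F ((F ^^ n) z + x *\<^sub>R q) = F ((F ^^ n) z) + x *\<^sub>R q'"
    using rays_F[of "(F ^^ n) z" q] by blast
  show ?case
    by (rule exI[of _ "min e e'"]) (use e e' in auto)
qed

text \<open>
  The eigenline through \<open>X\<close>, extended by the rule that \<open>F\<close> acts on the parameter as multiplication by
  \<open>\<mu>\<close>. Any sufficiently large number of iterations gives the same value.
\<close>

definition line :: "real \<Rightarrow> real \<times> real" where
  "line t = (let n = LEAST n. \<bar>t\<bar> \<le> r * \<bar>\<mu>\<bar> ^ n in (F ^^ n) (X + (t / \<mu> ^ n) *\<^sub>R v))"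

lemma mu_nz: "\<mu> \<noteq> 0" "\<bar>\<mu>\<bar> ^ n > 0"
  using mu by auto

lemma v_nz: "v \<noteq> 0"
  using indep by auto

lemma reach: "\<exists>n. c < r * \<bar>\<mu>\<bar> ^ n"
proof -
  obtain n where "c / r < \<bar>\<mu>\<bar> ^ n" using real_arch_pow[OF mu] by blast
  then show ?thesis using r_pos by (auto simp: field_simps)
qed

lemma reach_mono: "c \<le> r * \<bar>\<mu>\<bar> ^ n \<Longrightarrow> n \<le> m \<Longrightarrow> c \<le> r * \<bar>\<mu>\<bar> ^ m"
  using power_increasing[of n m "\<bar>\<mu>\<bar>"] mu r_pos
  by (meson less_imp_le mult_left_mono order_trans)

lemma line_eq:
  assumes "\<bar>t\<bar> \<le> r * \<bar>\<mu>\<bar> ^ n"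
  shows "line t = (F ^^ n) (X + (t / \<mu> ^ n) *\<^sub>R v)"
proof -
  have step: "(F ^^ (m + k)) (X + (t / \<mu> ^ (m + k)) *\<^sub>R v) = (F ^^ m) (X + (t / \<mu> ^ m) *\<^sub>R v)"
    if m: "\<bar>t\<bar> \<le> r * \<bar>\<mu>\<bar> ^ m" for m k
  proof (induction k)
    case (Suc k)
    have "\<bar>t\<bar> \<le> r * \<bar>\<mu>\<bar> ^ (m + Suc k)" by (rule reach_mono[OF m]) simp
    then have "\<bar>t / \<mu> ^ (m + Suc k)\<bar> \<le> r"
      using mu_nz(2)[of "m + Suc k"] by (simp only: abs_divide power_abs pos_divide_le_eq)
    then have "F (X + (t / \<mu> ^ (m + Suc k)) *\<^sub>R v) = X + (\<mu> * (t / \<mu> ^ (m + Suc k))) *\<^sub>R v"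
      using linear[of "t / \<mu> ^ (m + Suc k)" 0] r_pos by simp
    also have "\<mu> * (t / \<mu> ^ (m + Suc k)) = t / \<mu> ^ (m + k)" using mu_nz(1) by simp
    finally show ?case using Suc.IH by (simp add: funpow_swap1)
  qed simp
  define n0 where "n0 = (LEAST n. \<bar>t\<bar> \<le> r * \<bar>\<mu>\<bar> ^ n)"
  have "\<bar>t\<bar> \<le> r * \<bar>\<mu>\<bar> ^ n0" "n0 \<le> n"
    unfolding n0_def using assms by (rule LeastI, rule Least_le)
  then have "(F ^^ n) (X + (t / \<mu> ^ n) *\<^sub>R v) = (F ^^ n0) (X + (t / \<mu> ^ n0) *\<^sub>R v)"
    using step[of n0 "n - n0"] by simp
  then show ?thesis by (simp add: line_def Let_def n0_def)
qed

lemma line_near: "\<bar>t\<bar> \<le> r \<Longrightarrow> line t = X + t *\<^sub>R v"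
  using line_eq[of t 0] by simp

lemma line_0: "line 0 = X"
  using line_near[of 0] r_pos by simp

lemma F_line: "F (line t) = line (\<mu> * t)"
proof -
  obtain n where n: "\<bar>t\<bar> \<le> r * \<bar>\<mu>\<bar> ^ n" using reach less_imp_le by blast
  then have "\<bar>\<mu> * t\<bar> \<le> r * \<bar>\<mu>\<bar> ^ Suc n"
    using mult_left_mono[OF n, of "\<bar>\<mu>\<bar>"] by (simp add: abs_mult mult_ac)
  from line_eq[OF this] show ?thesis using mu_nz(1) by (simp add: line_eq[OF n])
qed

lemma G_line: "G (line t) = line (t / \<mu>)"
  using F_line[of "t / \<mu>"] GF mu_nz(1) by (metis nonzero_mult_div_cancel_left times_divide_eq_right)

lemma G_iter_line: "(G ^^ n) (line t) = line (t / \<mu> ^ n)"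
  by (induction n) (simp_all add: G_line mult.commute)

lemma line_local:
  assumes "\<bar>t\<bar> < r * \<bar>\<mu>\<bar> ^ n"
  shows "\<exists>d>0. \<forall>x. \<bar>x - t\<bar> \<le> d \<longrightarrow> line x = (F ^^ n) (X + (x / \<mu> ^ n) *\<^sub>R v)"
proof (intro exI conjI allI impI)
  show "r * \<bar>\<mu>\<bar> ^ n - \<bar>t\<bar> > 0" using assms by simp
  fix x assume "\<bar>x - t\<bar> \<le> r * \<bar>\<mu>\<bar> ^ n - \<bar>t\<bar>"
  then show "line x = (F ^^ n) (X + (x / \<mu> ^ n) *\<^sub>R v)" by (intro line_eq) linarith
qed

lemma cont_line: "continuous_on UNIV line"
  unfolding continuous_on_eq_continuous_at[OF open_UNIV]
proof
  fix t :: real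
  obtain n where "\<bar>t\<bar> < r * \<bar>\<mu>\<bar> ^ n" using reach by blast
  then obtain d where d: "d > 0" "\<And>x. \<bar>x - t\<bar> \<le> d \<Longrightarrow> line x = (F ^^ n) (X + (x / \<mu> ^ n) *\<^sub>R v)"
    using line_local by blast
  have "continuous_on UNIV (\<lambda>x. (F ^^ n) (X + (x / \<mu> ^ n) *\<^sub>R v))"
    by (rule continuous_on_compose2[OF cont_iter]) (auto intro!: continuous_intros simp: mu_nz)
  then have "isCont (\<lambda>x. (F ^^ n) (X + (x / \<mu> ^ n) *\<^sub>R v)) t"
    by (simp add: continuous_on_eq_continuous_at)
  moreover have "eventually (\<lambda>x. line x = (F ^^ n) (X + (x / \<mu> ^ n) *\<^sub>R v)) (nhds t)"
    unfolding eventually_nhds_metric using d by (auto simp: dist_real_def)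
  ultimately show "isCont line t" by (simp add: isCont_cong)
qed

lemma inj_line: "inj line"
proof
  fix t s assume eq: "line t = line s"
  obtain n where "max \<bar>t\<bar> \<bar>s\<bar> < r * \<bar>\<mu>\<bar> ^ n" using reach by blast
  then have n: "\<bar>t\<bar> \<le> r * \<bar>\<mu>\<bar> ^ n" "\<bar>s\<bar> \<le> r * \<bar>\<mu>\<bar> ^ n" by auto
  have "X + (t / \<mu> ^ n) *\<^sub>R v = X + (s / \<mu> ^ n) *\<^sub>R v"
    using eq inv_iter[of n] unfolding line_eq[OF n(1)] line_eq[OF n(2)] by metis
  then show "t = s" using v_nz mu_nz by simp
qed

lemma rays_line: "\<exists>e>0. \<exists>p q. \<forall>x\<in>{0..e}. line (t + x) = line t + x *\<^sub>R p \<and> line (t - x) = line t + x *\<^sub>R q"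
proof -
  obtain n where "\<bar>t\<bar> < r * \<bar>\<mu>\<bar> ^ n" using reach by blast
  then obtain d where d: "d > 0" "\<And>x. \<bar>x - t\<bar> \<le> d \<Longrightarrow> line x = (F ^^ n) (X + (x / \<mu> ^ n) *\<^sub>R v)"
    using line_local by blast
  define z u where "z = X + (t / \<mu> ^ n) *\<^sub>R v" and "u = (1 / \<mu> ^ n) *\<^sub>R v"
  have shift: "X + ((t + x) / \<mu> ^ n) *\<^sub>R v = z + x *\<^sub>R u" "X + ((t - x) / \<mu> ^ n) *\<^sub>R v = z + x *\<^sub>R (- u)" for x
    by (simp_all add: z_def u_def algebra_simps add_divide_distrib diff_divide_distrib)
  obtain e1 p where e1: "e1 > 0" "\<And>x. x \<in> {0..e1} \<Longrightarrow> (F ^^ n) (z + x *\<^sub>R u) = (F ^^ n) z + x *\<^sub>R p"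
    using rays_iter[of n z u] by blast
  obtain e2 q where e2: "e2 > 0" "\<And>x. x \<in> {0..e2} \<Longrightarrow> (F ^^ n) (z + x *\<^sub>R (- u)) = (F ^^ n) z + x *\<^sub>R q"
    using rays_iter[of n z "- u"] by blast
  have z: "line t = (F ^^ n) z" using d(2)[of t] d(1) by (simp add: z_def)
  show ?thesis
  proof (intro exI conjI ballI)
    show "min d (min e1 e2) > 0" using d e1 e2 by simp
    fix x assume x: "x \<in> {0..min d (min e1 e2)}"
    have "line (t + x) = (F ^^ n) (z + x *\<^sub>R u)" using d(2)[of "t + x"] x unfolding shift by simp
    then show "line (t + x) = line t + x *\<^sub>R p" using e1(2)[of x] x z by simp
    have "line (t - x) = (F ^^ n) (z + x *\<^sub>R (- u))" using d(2)[of "t - x"] x unfolding shift by simp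
    then show "line (t - x) = line t + x *\<^sub>R q" using e2(2)[of x] x z by simp
  qed
qed

text \<open>
  The coordinates of \<open>z - X\<close> in the basis \<open>v\<close>, \<open>w\<close>, by Cramer's rule.
\<close>

definition along :: "real \<times> real \<Rightarrow> real" where
  "along z = cross (z - X) w / cross v w"

definition across :: "real \<times> real \<Rightarrow> real" where
  "across z = cross v (z - X) / cross v w"

lemma coords: "z = X + along z *\<^sub>R v + across z *\<^sub>R w"
proof -
  have "z - X = (1 / cross v w) *\<^sub>R (cross v w *\<^sub>R (z - X))" using indep by simp
  also have "\<dots> = (1 / cross v w) *\<^sub>R (cross (z - X) w *\<^sub>R v + cross v (z - X) *\<^sub>R w)"
    by (rule arg_cong[OF cross_expand])
  also have "\<dots> = along z *\<^sub>R v + across z *\<^sub>R w"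
    by (simp add: along_def across_def scaleR_add_right)
  finally show ?thesis by (simp add: algebra_simps)
qed

lemma coords_point:
  "along (X + t *\<^sub>R v + s *\<^sub>R w) = t" "across (X + t *\<^sub>R v + s *\<^sub>R w) = s"
  using indep by (simp_all add: along_def across_def cross_distrib)

lemma coords_X: "along X = 0" "across X = 0"
  by (simp_all add: along_def across_def)

lemma cont_coords: "continuous_on S along" "continuous_on S across"
  unfolding along_def across_def using indep by (auto intro!: continuous_intros)

lemma coords_F:
  assumes "\<bar>along z\<bar> \<le> r" "\<bar>across z\<bar> \<le> r"
  shows "along (F z) = \<mu> * along z" "across (F z) = \<nu> * across z"
proof -
  have "F z = X + (\<mu> * along z) *\<^sub>R v + (\<nu> * across z) *\<^sub>R w"
    using linear[OF assms] coords[of z] by simp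
  then show "along (F z) = \<mu> * along z" "across (F z) = \<nu> * across z"
    using coords_point by simp_all
qed

lemma near_X:
  assumes "(f \<longlongrightarrow> X) A"
  shows "eventually (\<lambda>n. \<bar>along (f n)\<bar> < r \<and> \<bar>across (f n)\<bar> < r) A"
proof -
  have "isCont along X" "isCont across X"
    using cont_coords[of UNIV] continuous_on_eq_continuous_at[OF open_UNIV] by blast+
  then have "((\<lambda>n. along (f n)) \<longlongrightarrow> 0) A" "((\<lambda>n. across (f n)) \<longlongrightarrow> 0) A"
    using isCont_tendsto_compose[OF _ assms, of along] isCont_tendsto_compose[OF _ assms, of across]
    by (simp_all add: coords_X)
  then have "eventually (\<lambda>n. \<bar>along (f n)\<bar> < r) A" "eventually (\<lambda>n. \<bar>across (f n)\<bar> < r) A"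
    using r_pos by (auto simp: tendsto_iff dist_real_def)
  then show ?thesis by (rule eventually_conj)
qed

text \<open>
  A backward orbit that converges to \<open>X\<close> finally stays in the linear region, where \<open>G\<close> multiplies the
  coordinate across the eigenline by \<open>1 / \<nu>\<close>; this coordinate stays bounded only if it vanishes.
\<close>

lemma range_line: "range line = {T. (\<lambda>n. (G ^^ n) T) \<longlonglongrightarrow> X}"
proof (intro set_eqI iffI)
  fix T assume "T \<in> range line"
  then obtain t where T: "T = line t" by blast
  have "norm (1 / \<mu>) < 1" using mu by (simp add: norm_divide divide_less_eq)
  then have "(\<lambda>n. t * (1 / \<mu>) ^ n) \<longlonglongrightarrow> t * 0"
    by (intro tendsto_intros LIMSEQ_power_zero)
  moreover have "t * (1 / \<mu>) ^ n = t / \<mu> ^ n" for n by (simp add: power_divide)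
  ultimately have "(\<lambda>n. t / \<mu> ^ n) \<longlonglongrightarrow> 0" by simp
  moreover have "isCont line 0" using cont_line by (simp add: continuous_on_eq_continuous_at)
  ultimately have "(\<lambda>n. line (t / \<mu> ^ n)) \<longlonglongrightarrow> line 0" by (rule isCont_tendsto_compose[rotated])
  then show "T \<in> {T. (\<lambda>n. (G ^^ n) T) \<longlonglongrightarrow> X}"
    by (simp add: T G_iter_line line_0)
next
  fix T assume "T \<in> {T. (\<lambda>n. (G ^^ n) T) \<longlonglongrightarrow> X}"
  then have "(\<lambda>n. (G ^^ n) T) \<longlonglongrightarrow> X" by simp
  from near_X[OF this] obtain N where
    N: "\<And>n. n \<ge> N \<Longrightarrow> \<bar>along ((G ^^ n) T)\<bar> < r \<and> \<bar>across ((G ^^ n) T)\<bar> < r"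
    unfolding eventually_sequentially by blast
  define z where "z n = (G ^^ n) T" for n
  have pullback: "across (z (N + k)) * \<nu> ^ k = across (z N)" for k
  proof (induction k)
    case (Suc k)
    have "F (z (N + Suc k)) = z (N + k)" by (simp add: z_def FG)
    then have "across (z (N + k)) = \<nu> * across (z (N + Suc k))"
      using coords_F(2)[of "z (N + Suc k)"] N[of "N + Suc k"] unfolding z_def by fastforce
    then show ?case using Suc.IH by (simp add: mult_ac)
  qed simp
  have "\<bar>across (z N)\<bar> \<le> r * \<bar>\<nu>\<bar> ^ k" for k
  proof -
    have "\<bar>across (z N)\<bar> = \<bar>across (z (N + k))\<bar> * \<bar>\<nu>\<bar> ^ k"
      unfolding pullback[of k, symmetric] by (simp add: abs_mult power_abs)
    also have "\<dots> \<le> r * \<bar>\<nu>\<bar> ^ k"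
      using N[of "N + k"] by (intro mult_right_mono) (auto simp: z_def)
    finally show ?thesis .
  qed
  moreover have "(\<lambda>k. r * \<bar>\<nu>\<bar> ^ k) \<longlonglongrightarrow> r * 0"
    by (intro tendsto_intros LIMSEQ_power_zero) (use nu in simp)
  ultimately have "\<bar>across (z N)\<bar> \<le> r * 0"
    by (intro LIMSEQ_le_const) auto
  then have "z N = X + along (z N) *\<^sub>R v" using coords[of "z N"] by simp
  then have "z N = line (along (z N))" using line_near[of "along (z N)"] N[of N] by (simp add: z_def)
  then have "(F ^^ N) (z N) = (F ^^ N) (line (along (z N)))" by simp
  moreover have "(F ^^ k) (line t) = line (\<mu> ^ k * t)" for k t
    by (induction k) (simp_all add: F_line mult.assoc)
  ultimately show "T \<in> range line" by (simp add: z_def iter_inv)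
qed

text \<open>
  If an end of the line converged to a point of the line, the limit would be \<open>X\<close>, the only point of
  the line that is periodic. Then this end would remain in the linear region under all iterates of
  \<open>F\<close>, hence lie on the contracting eigenline. But \<open>F\<close> exchanges the two ends of the line iff \<open>\<mu> < 0\<close>,
  and exchanges the two sides of \<open>X\<close> on the contracting eigenline iff \<open>\<nu> < 0\<close>. As \<open>\<mu> * \<nu> < 0\<close>,
  either one end contains points on both sides of \<open>X\<close> and so passes through \<open>X\<close>, or both ends
  run into \<open>X\<close> from the same side and overlap; injectivity excludes either case.
\<close>

lemma no_limit:
  assumes \<sigma>: "\<sigma> \<in> {1, - 1}" and L: "L \<in> range line"
  shows "\<not> ((\<lambda>t. line (\<sigma> * t)) \<longlongrightarrow> L) at_top"
proof
  assume lim: "((\<lambda>t. line (\<sigma> * t)) \<longlongrightarrow> L) at_top"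
  have isF: "isCont F z" for z using cont_F continuous_on_eq_continuous_at[OF open_UNIV] by blast
  have mu2: "\<mu> * \<mu> > 1" using mu by (metis abs_mult_self_eq less_1_mult)
  have top: "filterlim (\<lambda>t. \<mu> * \<mu> * t) at_top at_top"
    by (rule filterlim_tendsto_pos_mult_at_top[OF tendsto_const _ filterlim_ident]) (use mu2 in simp)
  have "((\<lambda>t. F (F (line (\<sigma> * t)))) \<longlongrightarrow> F (F L)) at_top"
    by (intro isCont_tendsto_compose[OF isF] lim)
  moreover have "((\<lambda>t. line (\<sigma> * (\<mu> * \<mu> * t))) \<longlongrightarrow> L) at_top"
    by (rule filterlim_compose[OF lim top])
  ultimately have FFL: "F (F L) = L"
    by (intro tendsto_unique[OF trivial_limit_at_top_linorder]) (simp_all add: F_line mult_ac)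
  then have "(G ^^ (2 * n)) L = L" for n
  proof (induction n)
    case (Suc n)
    have "G (G L) = L" using GF FFL by metis
    then show ?case using Suc by simp
  qed simp
  moreover have "(\<lambda>n. (G ^^ (2 * n)) L) \<longlonglongrightarrow> X"
    using L unfolding range_line
    by (auto intro!: filterlim_compose[of "\<lambda>n. (G ^^ n) L" _ _ "\<lambda>n. 2 * n"] filterlim_subseq simp: strict_mono_def)
  ultimately have "L = X" by (simp add: LIMSEQ_const_iff)
  then have limX: "((\<lambda>t. line (\<sigma> * t)) \<longlongrightarrow> X) at_top" using lim by simp
  then have "((\<lambda>t. F (line (\<sigma> * t))) \<longlongrightarrow> X) at_top"
    using isCont_tendsto_compose[OF isF limX] by (simp add: FX)
  from eventually_conj[OF near_X[OF limX] near_X[OF this]] obtain t1 where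
    t1: "\<And>t. t \<ge> t1 \<Longrightarrow> \<bar>along (line (\<sigma> * t))\<bar> < r \<and> \<bar>across (line (\<sigma> * t))\<bar> < r \<and>
      \<bar>along (F (line (\<sigma> * t)))\<bar> < r \<and> \<bar>across (F (line (\<sigma> * t)))\<bar> < r"
    unfolding eventually_at_top_linorder by auto
  define t0 where "t0 = max t1 1"
  have t0: "t0 > 0" by (simp add: t0_def)
  have box: "\<bar>along (line (\<sigma> * t))\<bar> < r" "\<bar>across (line (\<sigma> * t))\<bar> < r"
      "\<bar>along (F (line (\<sigma> * t)))\<bar> < r" "\<bar>across (F (line (\<sigma> * t)))\<bar> < r" if "t \<ge> t0" for t
    using t1[of t] that by (auto simp: t0_def)
  \<comment> \<open>The coordinates of the end of the line; \<open>P\<close> is unbounded under iteration unless it vanishes.\<close>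
  define P where "P t = along (line (\<sigma> * t))" for t
  define Q where "Q t = across (line (\<sigma> * t))" for t
  have P2: "P (\<mu> * \<mu> * t) = \<mu> * \<mu> * P t" if "t \<ge> t0" for t
  proof -
    have "F (F (line (\<sigma> * t))) = line (\<sigma> * (\<mu> * \<mu> * t))" by (simp add: F_line mult_ac)
    then show ?thesis
      using coords_F(1)[of "line (\<sigma> * t)"] coords_F(1)[of "F (line (\<sigma> * t))"] box[OF that]
      by (simp add: P_def)
  qed
  have P0: "P t = 0" if t: "t \<ge> t0" for t
  proof (rule ccontr)
    assume "P t \<noteq> 0"
    have iter: "P ((\<mu> * \<mu>) ^ k * t) = (\<mu> * \<mu>) ^ k * P t \<and> (\<mu> * \<mu>) ^ k * t \<ge> t0" for k
    proof (induction k)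
      case (Suc k)
      have "(\<mu> * \<mu>) * ((\<mu> * \<mu>) ^ k * t) \<ge> 1 * ((\<mu> * \<mu>) ^ k * t)"
        using mu2 Suc t0 by (intro mult_right_mono) auto
      then show ?case using P2[of "(\<mu> * \<mu>) ^ k * t"] Suc by (simp add: mult.assoc)
    qed (use t in simp)
    obtain k where "r / \<bar>P t\<bar> < (\<mu> * \<mu>) ^ k" using real_arch_pow[OF mu2] by blast
    then have "r < (\<mu> * \<mu>) ^ k * \<bar>P t\<bar>" using \<open>P t \<noteq> 0\<close> by (simp add: pos_divide_less_eq)
    moreover have "\<bar>(\<mu> * \<mu>) ^ k * P t\<bar> = (\<mu> * \<mu>) ^ k * \<bar>P t\<bar>" using mu2 by (simp add: abs_mult)
    moreover have "\<bar>P ((\<mu> * \<mu>) ^ k * t)\<bar> < r" unfolding P_def using iter[of k] by (intro box(1)) simp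
    ultimately show False using iter[of k] by simp
  qed
  have on_w: "line (\<sigma> * t) = X + Q t *\<^sub>R w" if "t \<ge> t0" for t
    by (rule trans[OF coords]) (use P0[OF that] in \<open>simp add: P_def Q_def\<close>)
  have Q_nz: "Q t \<noteq> 0" if "t \<ge> t0" for t
  proof
    assume "Q t = 0"
    then have "line (\<sigma> * t) = line 0" using on_w[OF that] line_0 by simp
    then have "\<sigma> * t = 0" by (rule injD[OF inj_line])
    then show False using \<sigma> t0 that by auto
  qed
  have FQ: "line (\<sigma> * (\<mu> * t)) = X + (\<nu> * Q t) *\<^sub>R w" if "t \<ge> t0" for t
  proof -
    have "\<bar>Q t\<bar> \<le> r" using box(2)[OF that] by (simp add: Q_def)
    then have "F (X + Q t *\<^sub>R w) = X + (\<nu> * Q t) *\<^sub>R w"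
      using linear[of 0 "Q t"] r_pos by simp
    then have "F (line (\<sigma> * t)) = X + (\<nu> * Q t) *\<^sub>R w"
      by (simp only: on_w[OF that])
    then show ?thesis by (simp add: F_line mult_ac)
  qed
  have contQ: "continuous_on S Q" for S
    unfolding Q_def
    by (intro continuous_on_compose2[OF cont_coords(2)[of UNIV]] continuous_on_compose2[OF cont_line]
        continuous_intros subset_UNIV)
  show False
  proof (cases "\<mu> > 0")
    \<comment> \<open>\<open>F\<close> maps the end to itself and reverses the side.\<close>
    case True
    then have "\<mu> > 1" "\<nu> < 0" using mu mu_nu by (auto simp: mult_less_0_iff)
    then have le: "t0 \<le> \<mu> * t0" using t0 by simp
    have "X + Q (\<mu> * t0) *\<^sub>R w = X + (\<nu> * Q t0) *\<^sub>R w" using on_w[OF le] FQ[OF order_refl] by metis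
    moreover have "w \<noteq> 0" using indep by auto
    ultimately have "Q (\<mu> * t0) = \<nu> * Q t0" by simp
    then have "Q (\<mu> * t0) / Q t0 = \<nu>" using Q_nz[of t0] by simp
    moreover have "continuous_on {t0..\<mu> * t0} (\<lambda>t. Q t / Q t0)"
      using Q_nz[of t0] by (intro continuous_intros contQ) auto
    ultimately obtain x where "t0 \<le> x" "Q x / Q t0 = 0"
      using IVT2'[of "\<lambda>t. Q t / Q t0" "\<mu> * t0" 0 t0] le \<open>\<nu> < 0\<close> Q_nz[of t0] by auto
    then show False using Q_nz[of t0] Q_nz[of x] by simp
  next
    \<comment> \<open>\<open>F\<close> maps the end to the other one, on the same side.\<close>
    case False
    then have mn: "\<mu> < 0" "\<nu> > 0" using mu_nz(1) mu_nu by (auto simp: mult_less_0_iff)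
    have "isCont across X" using cont_coords(2)[of UNIV] continuous_on_eq_continuous_at[OF open_UNIV] by blast
    moreover have "Q = (\<lambda>t. across (line (\<sigma> * t)))" by (simp add: Q_def fun_eq_iff)
    ultimately have "(Q \<longlongrightarrow> 0) at_top"
      using isCont_tendsto_compose[OF _ limX, of across] by (simp add: coords_X)
    then have "eventually (\<lambda>t. \<bar>Q t\<bar> < \<nu> * \<bar>Q t0\<bar>) at_top"
      using mn Q_nz[of t0] by (auto simp: tendsto_iff dist_real_def)
    then obtain t2 where t2: "t2 \<ge> t0" "\<bar>Q t2\<bar> < \<nu> * \<bar>Q t0\<bar>"
      unfolding eventually_at_top_linorder by (metis max.cobounded1 max.cobounded2)
    have "Q t2 / Q t0 \<le> \<bar>Q t2\<bar> / \<bar>Q t0\<bar>" by (metis abs_divide abs_ge_self)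
    also have "\<dots> \<le> \<nu>" using t2(2) Q_nz[of t0] by (simp add: pos_divide_le_eq)
    finally have "Q t2 / Q t0 \<le> \<nu>" .
    moreover have "continuous_on {t0..t2} (\<lambda>t. Q t / Q t0)"
      using Q_nz[of t0] by (intro continuous_intros contQ) auto
    ultimately obtain x where x: "t0 \<le> x" "Q x / Q t0 = \<nu>"
      using IVT2'[of "\<lambda>t. Q t / Q t0" t2 \<nu> t0] t2 nu mn Q_nz[of t0] by auto
    then have "Q x = \<nu> * Q t0" using Q_nz[of t0] by (simp add: field_simps)
    then have "line (\<sigma> * x) = line (\<sigma> * (\<mu> * t0))" using on_w[OF x(1)] FQ[of t0] by simp
    then have "\<sigma> * x = \<sigma> * (\<mu> * t0)" by (rule injD[OF inj_line])
    then have "x = \<mu> * t0" using \<sigma> by auto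
    then show False using x(1) t0 mn mult_neg_pos[of \<mu> t0] by linarith
  qed
qed

sublocale broken_line line
proof
  show "continuous_on UNIV line" by (rule cont_line)
  show "inj line" by (rule inj_line)
  fix L assume L: "L \<in> range line"
  show "\<not> (line \<longlongrightarrow> L) at_top" using no_limit[of 1, OF _ L] by simp
  show "\<not> (line \<longlongrightarrow> L) at_bot" using no_limit[of "- 1", OF _ L] by (simp add: filterlim_at_bot_mirror)
qed (rule rays_line)

end

section \<open>One-sided or crossing\<close>

text \<open>
  Under \<open>G ^^ n\<close> the point \<open>T\<close> moves into the straight part of the expanding line, where the two sides
  of the line are distinguished by the sign of \<open>across\<close>. Either the moved curve \<open>\<gamma>\<close> changes this sign
  at \<open>s0\<close>, or it stays in a half disc; the image of the half disc under \<open>F ^^ n\<close> then shows that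
  \<open>\<gamma>\<close> is locally on one side of the line at \<open>T\<close>.
\<close>

lemma (in saddle) tangential_or_crossing:
  assumes \<gamma>: "broken_line \<gamma>" and T: "line t0 = T" "\<gamma> s0 = T"
    and iso: "isolated_intersection (range line) (range \<gamma>) T" and n: "\<bar>t0\<bar> < r * \<bar>\<mu>\<bar> ^ n"
  shows "tangential_intersection (range line) (range \<gamma>) T \<or>
    (\<exists>\<eta>>0. across ((G ^^ n) (\<gamma> (s0 - \<eta>))) * across ((G ^^ n) (\<gamma> (s0 + \<eta>))) < 0 \<and>
      (\<forall>s. \<bar>s - s0\<bar> \<le> \<eta> \<longrightarrow> across ((G ^^ n) (\<gamma> s)) = 0 \<longrightarrow> s = s0))"
proof -
  interpret C: broken_line \<gamma> by fact
  define h where "h = G ^^ n"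
  define \<tau>0 where "\<tau>0 = t0 / \<mu> ^ n"
  define \<kappa> where "\<kappa> s = h (\<gamma> s)" for s
  have cont_h: "continuous_on UNIV h"
    unfolding h_def
  proof (induction n)
    case (Suc n)
    then show ?case
      using continuous_on_compose[OF Suc.IH continuous_on_subset[OF cont_G]] by simp
  qed (simp add: id_def)
  have cont_\<kappa>: "continuous_on S \<kappa>" for S
    unfolding \<kappa>_def
    by (rule continuous_on_compose2[OF cont_h continuous_on_subset[OF C.cont]]) auto
  have h_line: "h (line t) = X + (t / \<mu> ^ n) *\<^sub>R v" if "\<bar>t\<bar> \<le> r * \<bar>\<mu>\<bar> ^ n" for t
    unfolding h_def by (subst line_eq[OF that]) (rule inv_iter)
  have hT: "h T = X + \<tau>0 *\<^sub>R v" using h_line[of t0] n T by (simp add: \<tau>0_def)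
  have \<kappa>0: "\<kappa> s0 = X + \<tau>0 *\<^sub>R v" using hT T by (simp add: \<kappa>_def)
  have coords0: "along (\<kappa> s0) = \<tau>0" "across (\<kappa> s0) = 0"
    using coords_point[of \<tau>0 0] by (simp_all add: \<kappa>0)
  obtain \<delta>0 where \<delta>0: "\<delta>0 > 0" "line ` {t0 - \<delta>0<..<t0 + \<delta>0} \<inter> \<gamma> ` {s0 - \<delta>0<..<s0 + \<delta>0} = {T}"
    using iso isolated_intersection_iff[OF injective_line_axioms C.injective_line_axioms T] by blast
  define \<delta> where "\<delta> = min \<delta>0 (r * \<bar>\<mu>\<bar> ^ n - \<bar>t0\<bar>)"
  have \<delta>: "\<delta> > 0" "\<delta> \<le> \<delta>0" using \<delta>0 n by (simp_all add: \<delta>_def)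
  have \<delta>T: "line ` {t0 - \<delta><..<t0 + \<delta>} \<inter> \<gamma> ` {s0 - \<delta><..<s0 + \<delta>} = {T}"
  proof
    have "line ` {t0 - \<delta><..<t0 + \<delta>} \<subseteq> line ` {t0 - \<delta>0<..<t0 + \<delta>0}"
      "\<gamma> ` {s0 - \<delta><..<s0 + \<delta>} \<subseteq> \<gamma> ` {s0 - \<delta>0<..<s0 + \<delta>0}"
      using \<delta>(2) by (auto intro!: image_mono)
    then show "line ` {t0 - \<delta><..<t0 + \<delta>} \<inter> \<gamma> ` {s0 - \<delta><..<s0 + \<delta>} \<subseteq> {T}"
      using \<delta>0(2) by blast
    show "{T} \<subseteq> line ` {t0 - \<delta><..<t0 + \<delta>} \<inter> \<gamma> ` {s0 - \<delta><..<s0 + \<delta>}"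
      using imageI[of t0 "{t0 - \<delta><..<t0 + \<delta>}" line] imageI[of s0 "{s0 - \<delta><..<s0 + \<delta>}" \<gamma>] T \<delta>(1)
      by simp
  qed
  have reach_\<delta>: "\<bar>t\<bar> \<le> r * \<bar>\<mu>\<bar> ^ n" if "\<bar>t - t0\<bar> < \<delta>" for t
    using that by (simp add: \<delta>_def) linarith
  define p where "p = \<bar>\<mu>\<bar> ^ n"
  have p: "p > 0" unfolding p_def by (rule mu_nz(2))
  have "isCont (\<lambda>s. along (\<kappa> s)) s0"
    by (rule continuous_on_interior[of UNIV])
      (use continuous_on_compose2[OF cont_coords(1)[of UNIV] cont_\<kappa>[of UNIV]] in auto)
  then obtain \<eta>1 where \<eta>1: "\<eta>1 > 0" "\<And>s. \<bar>s - s0\<bar> < \<eta>1 \<Longrightarrow> \<bar>along (\<kappa> s) - \<tau>0\<bar> < \<delta> / p"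
    using \<delta>(1) p unfolding continuous_at_eps_delta coords0(1)[symmetric] dist_real_def
    by (metis divide_pos_pos)
  define \<eta> where "\<eta> = min \<eta>1 \<delta> / 2"
  have \<eta>: "\<eta> > 0" "\<eta> < \<eta>1" "\<eta> < \<delta>" using \<eta>1(1) \<delta>(1) by (auto simp: \<eta>_def min_def)
  have only: "s = s0" if s: "\<bar>s - s0\<bar> \<le> \<eta>" and z: "across (\<kappa> s) = 0" for s
  proof -
    define t where "t = along (\<kappa> s) * \<mu> ^ n"
    \<comment> \<open>A common point of the moved curve and the eigenline comes from parameters so close to \<open>t0\<close> and
        \<open>s0\<close> that isolation applies.\<close>
    have "t - t0 = (along (\<kappa> s) - \<tau>0) * \<mu> ^ n" using mu_nz(1) by (simp add: t_def \<tau>0_def left_diff_distrib)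
    then have "\<bar>t - t0\<bar> = \<bar>along (\<kappa> s) - \<tau>0\<bar> * p" by (simp add: abs_mult p_def power_abs)
    moreover have "\<bar>along (\<kappa> s) - \<tau>0\<bar> * p < \<delta>"
      using \<eta>1(2)[of s] s \<eta> p by (simp add: pos_less_divide_eq)
    ultimately have td: "\<bar>t - t0\<bar> < \<delta>" by simp
    have "\<kappa> s = X + along (\<kappa> s) *\<^sub>R v + across (\<kappa> s) *\<^sub>R w" by (rule coords)
    also have "\<dots> = h (line t)" using h_line[OF reach_\<delta>[OF td]] mu_nz(1) by (simp add: z t_def)
    finally have "(F ^^ n) (h (\<gamma> s)) = (F ^^ n) (h (line t))" by (simp only: \<kappa>_def)
    then have "\<gamma> s = line t" unfolding h_def iter_inv .
    moreover have "\<gamma> s \<in> \<gamma> ` {s0 - \<delta><..<s0 + \<delta>}" using s \<eta> by (intro imageI) auto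
    moreover have "line t \<in> line ` {t0 - \<delta><..<t0 + \<delta>}" using td by (intro imageI) auto
    ultimately have "\<gamma> s \<in> {T}" using \<delta>T by auto
    then have "\<gamma> s = \<gamma> s0" using T(2) by simp
    then show "s = s0" by (rule injD[OF C.inj])
  qed
  define g where "g s = across (\<kappa> s)" for s
  have cont_g: "continuous_on S g" for S
    unfolding g_def by (rule continuous_on_compose2[OF cont_coords(2)[of UNIV] cont_\<kappa>]) auto
  have nz: "g s \<noteq> 0" if "\<bar>s - s0\<bar> \<le> \<eta>" "s \<noteq> s0" for s using only that by (auto simp: g_def)
  show ?thesis
  proof (cases "g (s0 - \<eta>) * g (s0 + \<eta>) < 0")
    case True
    then show ?thesis
      using \<eta>(1) only by (intro disjI2 exI[of _ \<eta>]) (auto simp: g_def \<kappa>_def h_def)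
  next
    case False
    define \<sigma> where "\<sigma> = sgn (g (s0 + \<eta>))"
    have \<sigma>: "\<sigma> * g (s0 + \<eta>) > 0" "\<sigma> * g (s0 - \<eta>) > 0" "\<sigma> \<noteq> 0"
      using nz[of "s0 + \<eta>"] nz[of "s0 - \<eta>"] \<eta>(1) False
      by (auto simp: \<sigma>_def sgn_if not_less zero_le_mult_iff)
    have side: "\<sigma> * g s > 0" if s: "0 < \<bar>s - s0\<bar>" "\<bar>s - s0\<bar> \<le> \<eta>" for s
    proof (rule ccontr)
      assume neg: "\<not> \<sigma> * g s > 0"
      have c: "continuous_on S (\<lambda>s. \<sigma> * g s)" for S by (intro continuous_intros cont_g)
      show False
      proof (cases "s < s0")
        case True
        then obtain x where "s0 - \<eta> \<le> x" "x \<le> s" "\<sigma> * g x = 0"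
          using IVT2'[of "\<lambda>s. \<sigma> * g s" s 0 "s0 - \<eta>"] c neg s \<sigma>(2) by auto
        then show False using nz[of x] True \<sigma>(3) \<eta>(1) by auto
      next
        case False
        then obtain x where "s \<le> x" "x \<le> s0 + \<eta>" "\<sigma> * g x = 0"
          using IVT'[of "\<lambda>s. \<sigma> * g s" s 0 "s0 + \<eta>"] c neg s \<sigma>(1) by auto
        then show False using nz[of x] False s \<sigma>(3) \<eta>(1) by auto
      qed
    qed
    have "tangential_intersection (range line) (range \<gamma>) T"
    proof (rule one_sided_imp_tangential[OF broken_line_axioms \<gamma> T \<delta>(1) \<delta>T])
      fix \<epsilon> :: real assume \<epsilon>: "\<epsilon> > 0"
      have "isCont (F ^^ n) (h T)"
        using cont_iter continuous_on_eq_continuous_at[OF open_UNIV] by blast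
      moreover have "(F ^^ n) (h T) = T" unfolding h_def by (rule iter_inv)
      ultimately obtain \<rho> where \<rho>: "\<rho> > 0" "\<And>z. dist z (h T) < \<rho> \<Longrightarrow> dist ((F ^^ n) z) T < \<epsilon>"
        using \<epsilon> unfolding continuous_at_eps_delta by metis
      define c where "c = (\<sigma> / cross v w) *\<^sub>R v"
      define H where "H = {z \<in> ball (h T) \<rho>. cross c (z - h T) > 0}"
      have side_H: "cross c (z - h T) = \<sigma> * across z" for z
        by (simp add: c_def hT across_def cross_distrib diff_divide_distrib right_diff_distrib)
      have "isCont \<kappa> s0" using cont_\<kappa>[of UNIV] continuous_on_eq_continuous_at[OF open_UNIV] by blast
      then obtain \<eta>2 where \<eta>2: "\<eta>2 > 0" "\<And>s. \<bar>s - s0\<bar> < \<eta>2 \<Longrightarrow> dist (\<kappa> s) (h T) < \<rho>"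
        using \<rho>(1) unfolding continuous_at_eps_delta dist_real_def hT \<kappa>0[symmetric] by metis
      show "\<exists>B \<eta>. connected B \<and> B \<subseteq> ball T \<epsilon> \<and> B \<inter> line ` {t0 - \<delta><..<t0 + \<delta>} = {} \<and>
        \<eta> > 0 \<and> (\<forall>x. 0 < \<bar>x - s0\<bar> \<and> \<bar>x - s0\<bar> < \<eta> \<longrightarrow> \<gamma> x \<in> B)"
      proof (intro exI conjI allI impI)
        show "connected ((F ^^ n) ` H)"
          unfolding H_def
          by (intro connected_continuous_image continuous_on_subset[OF cont_iter] convex_connected half_disc) simp
        show "(F ^^ n) ` H \<subseteq> ball T \<epsilon>"
          using \<rho>(2) by (auto simp: H_def dist_commute)
        show "(F ^^ n) ` H \<inter> line ` {t0 - \<delta><..<t0 + \<delta>} = {}"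
        proof (rule ccontr)
          assume "\<not> ?thesis"
          then obtain z t where z: "z \<in> H" "t \<in> {t0 - \<delta><..<t0 + \<delta>}" "(F ^^ n) z = line t" by blast
          then have t: "\<bar>t - t0\<bar> < \<delta>" by auto
          have "z = h (line t)" using z(3) unfolding h_def by (metis inv_iter)
          also have "\<dots> = X + (t / \<mu> ^ n) *\<^sub>R v + 0 *\<^sub>R w" using h_line[OF reach_\<delta>[OF t]] by simp
          finally have "across z = 0" by (simp only: coords_point)
          then show False using z(1) side_H[of z] by (simp add: H_def)
        qed
        show "min \<eta> \<eta>2 > 0" using \<eta>(1) \<eta>2(1) by simp
        fix x assume x: "0 < \<bar>x - s0\<bar> \<and> \<bar>x - s0\<bar> < min \<eta> \<eta>2"
        then have "\<kappa> x \<in> H"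
          using \<eta>2(2)[of x] side[of x] side_H[of "\<kappa> x"] by (simp add: H_def g_def dist_commute)
        then have "(F ^^ n) (\<kappa> x) \<in> (F ^^ n) ` H" by (rule imageI)
        then show "\<gamma> x \<in> (F ^^ n) ` H" unfolding \<kappa>_def h_def iter_inv .
      qed
    qed
    then show ?thesis by simp
  qed
qed

section \<open>The saddle of the Lozi map\<close>

definition lozi_inv :: "real \<Rightarrow> real \<Rightarrow> real \<times> real \<Rightarrow> real \<times> real" where
  "lozi_inv a b = (\<lambda>(u, v). (v / b, u - 1 + a * \<bar>v / b\<bar>))"

lemma lozi_inv_inverse:
  assumes "b \<noteq> 0"
  shows "lozi_inv a b (lozi a b z) = z" "lozi a b (lozi_inv a b z) = z"
  using assms by (cases z; simp add: lozi_def lozi_inv_def abs_mult)+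

lemma inv_lozi: "b \<noteq> 0 \<Longrightarrow> inv (lozi a b) = lozi_inv a b"
  by (rule inv_unique_comp) (simp_all add: fun_eq_iff lozi_inv_inverse)

lemma lozi_eq: "lozi a b z = (1 + snd z - a * \<bar>fst z\<bar>, b * fst z)"
  by (simp add: lozi_def case_prod_beta)

lemma lozi_inv_eq: "lozi_inv a b z = (snd z / b, fst z - 1 + a * \<bar>snd z / b\<bar>)"
  by (simp add: lozi_inv_def case_prod_beta)

text \<open>
  The only source of corners is the absolute value, which has one-sided derivatives everywhere.
\<close>

lemma abs_along_ray:
  fixes c d :: real
  shows "\<exists>e>0. \<exists>k. \<forall>x\<in>{0..e}. \<bar>c + x * d\<bar> = \<bar>c\<bar> + x * k"
proof (cases "c = 0")
  case True
  then show ?thesis by (intro exI[of _ 1] conjI exI[of _ "\<bar>d\<bar>"]) (auto simp: abs_mult)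
next
  case False
  define e where "e = \<bar>c\<bar> / (\<bar>d\<bar> + 1)"
  have e: "e > 0" using False by (simp add: e_def)
  have small: "\<bar>x * d\<bar> \<le> \<bar>c\<bar>" if "x \<in> {0..e}" for x
  proof -
    have "\<bar>x * d\<bar> \<le> x * (\<bar>d\<bar> + 1)" using that by (simp add: abs_mult algebra_simps)
    also have "\<dots> \<le> e * (\<bar>d\<bar> + 1)" using that by (intro mult_right_mono) auto
    also have "\<dots> = \<bar>c\<bar>" by (simp add: e_def)
    finally show ?thesis .
  qed
  have "\<bar>c + x * d\<bar> = \<bar>c\<bar> + x * (sgn c * d)" if "x \<in> {0..e}" for x
  proof (cases "c > 0")
    case True
    then have "c + x * d \<ge> 0" using small[OF that] by linarith
    then show ?thesis using True by simp
  next
    case neg: False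
    then have "c + x * d \<le> 0" using small[OF that] by linarith
    then show ?thesis using neg False by (simp add: abs_of_nonpos)
  qed
  then show ?thesis using e by blast
qed

lemma lozi_rays: "\<exists>e>0. \<exists>q. \<forall>x\<in>{0..e}. lozi a b (z + x *\<^sub>R p) = lozi a b z + x *\<^sub>R q"
proof -
  obtain e k where e: "e > 0" "\<And>x. x \<in> {0..e} \<Longrightarrow> \<bar>fst z + x * fst p\<bar> = \<bar>fst z\<bar> + x * k"
    using abs_along_ray by blast
  have "lozi a b (z + x *\<^sub>R p) = lozi a b z + x *\<^sub>R (snd p - a * k, b * fst p)" if "x \<in> {0..e}" for x
    using e(2)[OF that] by (simp add: lozi_eq algebra_simps)
  then show ?thesis using e(1) by blast
qed

lemma lozi_inv_rays: "\<exists>e>0. \<exists>q. \<forall>x\<in>{0..e}. lozi_inv a b (z + x *\<^sub>R p) = lozi_inv a b z + x *\<^sub>R q"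
proof -
  obtain e k where e: "e > 0" "\<And>x. x \<in> {0..e} \<Longrightarrow> \<bar>snd z / b + x * (snd p / b)\<bar> = \<bar>snd z / b\<bar> + x * k"
    using abs_along_ray by blast
  have "lozi_inv a b (z + x *\<^sub>R p) = lozi_inv a b z + x *\<^sub>R (snd p / b, fst p + a * k)" if "x \<in> {0..e}" for x
  proof -
    have "snd (z + x *\<^sub>R p) / b = snd z / b + x * (snd p / b)" by (simp add: add_divide_distrib)
    then show ?thesis using e(2)[OF that] by (simp add: lozi_inv_eq algebra_simps)
  qed
  then show ?thesis using e(1) by blast
qed

lemma continuous_on_lozi: "continuous_on S (lozi a b)"
  unfolding lozi_def case_prod_beta by (intro continuous_intros)

lemma continuous_on_lozi_inv: "b \<noteq> 0 \<Longrightarrow> continuous_on S (lozi_inv a b)"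
  unfolding lozi_inv_def case_prod_beta by (intro continuous_intros) auto

definition lam_u :: "real \<Rightarrow> real \<Rightarrow> real" where
  "lam_u a b = (- a - sqrt (a\<^sup>2 + 4 * b)) / 2"

definition lam_s :: "real \<Rightarrow> real \<Rightarrow> real" where
  "lam_s a b = (- a + sqrt (a\<^sup>2 + 4 * b)) / 2"

definition vec_u :: "real \<Rightarrow> real \<Rightarrow> real \<times> real" where
  "vec_u a b = (lam_u a b, b)"

definition vec_s :: "real \<Rightarrow> real \<Rightarrow> real \<times> real" where
  "vec_s a b = (lam_s a b, b)"

locale lozi_params =
  fixes a b :: real
  assumes b_pos: "0 < b" and b_less: "b < 1" and ab: "a + b > 1"
begin

abbreviation "X \<equiv> lozi_fix a b"
abbreviation "lu \<equiv> lam_u a b"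
abbreviation "ls \<equiv> lam_s a b"
abbreviation "eu \<equiv> vec_u a b"
abbreviation "es \<equiv> vec_s a b"

lemma a_pos: "a > 0"
  using b_less ab by linarith

lemma fix_coords: "fst X > 0" "snd X = b * fst X" "1 + b * fst X - a * fst X = fst X"
  using a_pos b_less by (simp_all add: lozi_fix_def field_simps)

text \<open>
  The eigenvalues are the roots of \<open>x\<^sup>2 + a * x - b\<close>.
\<close>

lemma eigenvalue_eqs: "lu + ls = - a" "lu * ls = - b" "lu\<^sup>2 = b - a * lu" "ls\<^sup>2 = b - a * ls"
proof -
  define D where "D = sqrt (a\<^sup>2 + 4 * b)"
  have D: "D\<^sup>2 = a\<^sup>2 + 4 * b" using b_pos by (simp add: D_def)
  have lD: "2 * lu = - a - D" "2 * ls = - a + D" by (simp_all add: lam_u_def lam_s_def D_def)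
  then show "lu + ls = - a" by linarith
  have "4 * (lu * ls) = (2 * lu) * (2 * ls)" by simp
  also have "\<dots> = a\<^sup>2 - D\<^sup>2"
    unfolding lD by (simp add: algebra_simps power2_eq_square)
  finally have "4 * (lu * ls) = a\<^sup>2 - D\<^sup>2" .
  then show prod: "lu * ls = - b" unfolding D by linarith
  have "lu\<^sup>2 = lu * (lu + ls) - lu * ls" "ls\<^sup>2 = ls * (lu + ls) - lu * ls"
    by (simp_all add: algebra_simps power2_eq_square)
  then show "lu\<^sup>2 = b - a * lu" "ls\<^sup>2 = b - a * ls"
    unfolding \<open>lu + ls = - a\<close> prod by (simp_all add: algebra_simps)
qed

lemma eigenvalue_bounds: "lu < - 1" "0 < ls" "ls < 1"
proof -
  let ?D = "sqrt (a\<^sup>2 + 4 * b)"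
  have "sqrt (a\<^sup>2) < ?D" using b_pos by (intro real_sqrt_less_mono) simp
  then have Da: "a < ?D" using a_pos by simp
  have "sqrt ((2 - a)\<^sup>2) < ?D"
    using ab by (intro real_sqrt_less_mono) (simp add: power2_eq_square algebra_simps)
  then have D2: "2 - a < ?D" by simp
  have "?D < sqrt ((2 + a)\<^sup>2)"
    using a_pos b_less by (intro real_sqrt_less_mono) (simp add: power2_eq_square algebra_simps)
  then have D3: "?D < 2 + a" using a_pos by simp
  show "lu < - 1" "0 < ls" "ls < 1"
    using Da D2 D3 by (simp_all add: lam_u_def lam_s_def)
qed

lemma cross_eu_es: "cross eu es \<noteq> 0"
proof -
  have "cross eu es = b * (lu - ls)" by (simp add: cross_def vec_u_def vec_s_def algebra_simps)
  then show ?thesis using eigenvalue_bounds b_pos by simp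
qed

text \<open>
  On the half-plane of nonnegative first coordinate the Lozi map is affine and fixes \<open>X\<close>.
\<close>

lemma lozi_affine:
  assumes "fst X + t * lu + s * ls \<ge> 0"
  shows "lozi a b (X + t *\<^sub>R eu + s *\<^sub>R es) = X + (lu * t) *\<^sub>R eu + (ls * s) *\<^sub>R es"
proof -
  have "1 + (snd X + t * b + s * b) - a * (fst X + t * lu + s * ls)
      = (1 + b * fst X - a * fst X) + t * (b - a * lu) + s * (b - a * ls)"
    unfolding fix_coords(2) by (simp add: algebra_simps)
  also have "\<dots> = fst X + t * lu\<^sup>2 + s * ls\<^sup>2"
    unfolding fix_coords(3) eigenvalue_eqs(3,4) ..
  finally have "1 + (snd X + t * b + s * b) - a * (fst X + t * lu + s * ls) = fst X + t * lu\<^sup>2 + s * ls\<^sup>2" .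
  then show ?thesis
    using assms fix_coords(2)
    by (simp add: lozi_eq vec_u_def vec_s_def prod_eq_iff power2_eq_square algebra_simps)
qed

lemma lozi_inv_affine:
  assumes "fst X + t + s \<ge> 0"
  shows "lozi_inv a b (X + t *\<^sub>R eu + s *\<^sub>R es) = X + (t / lu) *\<^sub>R eu + (s / ls) *\<^sub>R es"
proof -
  have nz: "lu \<noteq> 0" "ls \<noteq> 0" using eigenvalue_bounds by auto
  have "lozi a b (X + (t / lu) *\<^sub>R eu + (s / ls) *\<^sub>R es) = X + t *\<^sub>R eu + s *\<^sub>R es"
    using lozi_affine[of "t / lu" "s / ls"] assms nz by simp
  then have "lozi_inv a b (X + t *\<^sub>R eu + s *\<^sub>R es) =
      lozi_inv a b (lozi a b (X + (t / lu) *\<^sub>R eu + (s / ls) *\<^sub>R es))" by simp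
  then show ?thesis using lozi_inv_inverse(1) b_pos by simp
qed

sublocale U: saddle "lozi a b" "lozi_inv a b" X eu es lu ls "fst X / (2 * \<bar>lu\<bar>)"
proof
  fix t s assume t: "\<bar>t\<bar> \<le> fst X / (2 * \<bar>lu\<bar>)" and s: "\<bar>s\<bar> \<le> fst X / (2 * \<bar>lu\<bar>)"
  have lu: "\<bar>lu\<bar> > 1" using eigenvalue_bounds by simp
  have "\<bar>t * lu\<bar> \<le> fst X / 2" using t lu by (simp add: abs_mult field_simps)
  moreover have "\<bar>s * ls\<bar> \<le> fst X / 2"
  proof -
    have "\<bar>s * ls\<bar> \<le> \<bar>s\<bar> * \<bar>lu\<bar>"
      unfolding abs_mult using eigenvalue_bounds by (intro mult_left_mono) auto
    also have "\<dots> \<le> fst X / 2" using s lu by (simp add: field_simps)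
    finally show ?thesis .
  qed
  ultimately show "lozi a b (X + t *\<^sub>R eu + s *\<^sub>R es) = X + (lu * t) *\<^sub>R eu + (ls * s) *\<^sub>R es"
    by (intro lozi_affine) linarith
next
  have "lu \<noteq> 0" using eigenvalue_bounds by simp
  then show "fst X / (2 * \<bar>lu\<bar>) > 0" using fix_coords(1) by simp
  show "1 < \<bar>lu\<bar>" "\<bar>ls\<bar> < 1" "lu * ls < 0"
    using eigenvalue_bounds eigenvalue_eqs(2) b_pos by simp_all
qed (use b_pos in \<open>simp_all only: lozi_rays cross_eu_es continuous_on_lozi continuous_on_lozi_inv lozi_inv_inverse
  less_imp_neq not_sym not_False_eq_True\<close>)

sublocale S: saddle "lozi_inv a b" "lozi a b" X es eu "1 / ls" "1 / lu" "fst X / 2"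
proof
  fix t s assume "\<bar>t\<bar> \<le> fst X / 2" "\<bar>s\<bar> \<le> fst X / 2"
  then show "lozi_inv a b (X + t *\<^sub>R es + s *\<^sub>R eu) = X + (1 / ls * t) *\<^sub>R es + (1 / lu * s) *\<^sub>R eu"
    using lozi_inv_affine[of s t] by (simp add: algebra_simps)
next
  show "1 < \<bar>1 / ls\<bar>" using eigenvalue_bounds by simp
  have "\<bar>lu\<bar> > 1" using eigenvalue_bounds by simp
  then show "\<bar>1 / lu\<bar> < 1" by (simp only: abs_divide abs_one) (simp add: divide_less_eq)
  show "1 / ls * (1 / lu) < 0" using eigenvalue_bounds by (simp add: mult_pos_neg)
  show "cross es eu \<noteq> 0" using cross_eu_es cross_skew[of es eu] by simp
  show "fst X / 2 > 0" using fix_coords(1) by simp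
qed (use b_pos in \<open>simp_all only: lozi_inv_rays continuous_on_lozi continuous_on_lozi_inv lozi_inv_inverse\<close>)

lemma unstable_mfd_eq: "unstable_mfd a b = range U.line"
  using b_pos by (simp add: unstable_mfd_def U.range_line inv_lozi)

lemma stable_mfd_eq: "stable_mfd a b = range S.line"
  by (simp add: stable_mfd_def S.range_line)

text \<open>
  This and the next lemma exhibit points of the two manifolds by bounds that depend continuously on
  the parameters, so that they can be applied to all nearby parameters at once.
\<close>

lemma unstable_segment:
  assumes "\<bar>t * lu\<bar> \<le> fst X"
  shows "X + t *\<^sub>R eu \<in> unstable_mfd a b"
proof -
  have lu: "\<bar>lu\<bar> > 1" using eigenvalue_bounds by simp
  have bound: "\<bar>t / lu ^ n\<bar> \<le> fst X" for n
  proof -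
    have "\<bar>t / lu ^ n\<bar> \<le> \<bar>t\<bar>" using lu by (simp add: abs_divide power_abs divide_le_eq mult_le_cancel_left1 one_le_power)
    also have "\<dots> \<le> \<bar>t\<bar> * \<bar>lu\<bar>" using lu by (simp add: mult_le_cancel_left1)
    also have "\<dots> \<le> fst X" using assms by (simp add: abs_mult)
    finally show ?thesis .
  qed
  have iter: "(lozi_inv a b ^^ n) (X + t *\<^sub>R eu) = X + (t / lu ^ n) *\<^sub>R eu" for n
  proof (induction n)
    case (Suc n)
    have "fst X + t / lu ^ n + 0 \<ge> 0" using bound[of n] by (simp only: abs_le_iff) linarith
    from lozi_inv_affine[OF this] show ?case by (simp add: Suc mult.commute)
  qed simp
  have "norm (1 / lu) < 1" using lu by (simp add: norm_divide divide_less_eq)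
  then have "(\<lambda>n. X + (t * (1 / lu) ^ n) *\<^sub>R eu) \<longlonglongrightarrow> X + (t * 0) *\<^sub>R eu"
    by (intro tendsto_intros LIMSEQ_power_zero)
  then show ?thesis using b_pos by (simp add: unstable_mfd_def inv_lozi iter power_divide)
qed

lemma stable_preimage:
  assumes "\<bar>s\<bar> \<le> fst X"
  shows "(lozi_inv a b ^^ N) (X + s *\<^sub>R es) \<in> stable_mfd a b"
proof -
  have iter: "(lozi a b ^^ n) (X + s *\<^sub>R es) = X + (ls ^ n * s) *\<^sub>R es" for n
  proof (induction n)
    case (Suc n)
    have "\<bar>(ls ^ n * s) * ls\<bar> \<le> 1 * \<bar>s\<bar>"
      using eigenvalue_bounds power_le_one[of ls "Suc n"]
      unfolding abs_mult by (simp add: mult_right_le_one_le mult_left_le_one_le mult_ac)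
    then have "fst X + 0 * lu + (ls ^ n * s) * ls \<ge> 0" using assms by linarith
    from lozi_affine[OF this] show ?case by (simp add: Suc mult.assoc)
  qed simp
  have "norm ls < 1" using eigenvalue_bounds by simp
  then have "(\<lambda>n. X + (ls ^ n * s) *\<^sub>R es) \<longlonglongrightarrow> X + (0 * s) *\<^sub>R es"
    by (intro tendsto_intros LIMSEQ_power_zero)
  then have "(\<lambda>n. (lozi a b ^^ n) (X + s *\<^sub>R es)) \<longlonglongrightarrow> X" by (simp add: iter)
  moreover have "(lozi a b ^^ (n + N)) ((lozi_inv a b ^^ N) (X + s *\<^sub>R es)) = (lozi a b ^^ n) (X + s *\<^sub>R es)" for n
    by (simp add: funpow_add U.iter_inv)
  ultimately have "(\<lambda>n. (lozi a b ^^ (n + N)) ((lozi_inv a b ^^ N) (X + s *\<^sub>R es))) \<longlonglongrightarrow> X" by simp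
  then show ?thesis unfolding stable_mfd_def by (simp only: mem_Collect_eq) (rule LIMSEQ_offset)
qed

end

section \<open>Crossings persist\<close>

lemma tendsto_lozi_fix:
  assumes "A \<longlonglongrightarrow> a" "B \<longlonglongrightarrow> b" "1 + a - b \<noteq> 0"
  shows "(\<lambda>n. lozi_fix (A n) (B n)) \<longlonglongrightarrow> lozi_fix a b"
  unfolding lozi_fix_def using assms by (intro tendsto_intros) auto

lemma tendsto_vec:
  assumes "A \<longlonglongrightarrow> a" "B \<longlonglongrightarrow> b"
  shows "(\<lambda>n. vec_u (A n) (B n)) \<longlonglongrightarrow> vec_u a b" "(\<lambda>n. vec_s (A n) (B n)) \<longlonglongrightarrow> vec_s a b"
  unfolding vec_u_def vec_s_def lam_u_def lam_s_def using assms by (auto intro!: tendsto_intros)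

lemma tendsto_lozi_inv_iter:
  assumes "A \<longlonglongrightarrow> a" "B \<longlonglongrightarrow> b" "b \<noteq> 0" "Z \<longlonglongrightarrow> z"
  shows "(\<lambda>n. (lozi_inv (A n) (B n) ^^ N) (Z n)) \<longlonglongrightarrow> (lozi_inv a b ^^ N) z"
proof (induction N)
  case (Suc N)
  have step: "(\<lambda>n. lozi_inv (A n) (B n) (W n)) \<longlonglongrightarrow> lozi_inv a b u" if "W \<longlonglongrightarrow> u" for W u
    unfolding lozi_inv_eq using assms that by (intro tendsto_intros) auto
  show ?case using step[OF Suc.IH] by simp
qed (use assms in simp)

text \<open>
  For fixed \<open>N\<close>, a piece of the stable manifold that depends continuously on the parameters and \<open>s\<close>.
\<close>

definition stable_arc :: "nat \<Rightarrow> real \<Rightarrow> real \<Rightarrow> real \<Rightarrow> real \<times> real" where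
  "stable_arc N a b s = (lozi_inv a b ^^ N) (lozi_fix a b + s *\<^sub>R vec_s a b)"

lemma tendsto_stable_arc:
  assumes "A \<longlonglongrightarrow> a" "B \<longlonglongrightarrow> b" "b \<noteq> 0" "1 + a - b \<noteq> 0" "S \<longlonglongrightarrow> s"
  shows "(\<lambda>n. stable_arc N (A n) (B n) (S n)) \<longlonglongrightarrow> stable_arc N a b s"
  unfolding stable_arc_def
  by (intro tendsto_lozi_inv_iter tendsto_add tendsto_scaleR tendsto_lozi_fix tendsto_vec assms)

text \<open>
  Suppose that the stable arc passes from one side of the expanding eigenline to the other and hits
  it only on the part that belongs to the unstable manifold, away from \<open>X\<close>. For nearby parameters
  the ends of the arc are still on different sides, so the intermediate value theorem gives a point of
  the arc on the new eigenline. Its limit points are hits for \<open>(a, b)\<close>, hence it lies on the admissible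
  part of the eigenline as well, and is homoclinic.
\<close>

lemma crossing_imp_interior:
  assumes "lozi_params a b" and s12: "s1 < s2"
    and small: "\<bar>s1\<bar> < fst (lozi_fix a b)" "\<bar>s2\<bar> < fst (lozi_fix a b)"
    and cross: "cross (vec_u a b) (stable_arc N a b s1 - lozi_fix a b) *
      cross (vec_u a b) (stable_arc N a b s2 - lozi_fix a b) < 0"
    and hit: "\<And>s. s1 \<le> s \<Longrightarrow> s \<le> s2 \<Longrightarrow> cross (vec_u a b) (stable_arc N a b s - lozi_fix a b) = 0 \<Longrightarrow>
      0 < \<bar>fst (stable_arc N a b s) - fst (lozi_fix a b)\<bar> \<and>
      \<bar>fst (stable_arc N a b s) - fst (lozi_fix a b)\<bar> < fst (lozi_fix a b)"
  shows "(a, b) \<in> interior homoclinic_params"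
proof (rule ccontr)
  assume "(a, b) \<notin> interior homoclinic_params"
  then have "(a, b) \<in> closure (- homoclinic_params)" by (simp add: closure_complement)
  then obtain c where c: "\<And>n. c n \<notin> homoclinic_params" "c \<longlonglongrightarrow> (a, b)"
    unfolding closure_sequential by auto
  interpret lozi_params a b by fact
  have nz: "b \<noteq> 0" "1 + a - b \<noteq> 0" using b_pos a_pos b_less by auto
  define A B where "A n = fst (c n)" and "B n = snd (c n)" for n
  have lim: "A \<longlonglongrightarrow> a" "B \<longlonglongrightarrow> b"
    unfolding A_def B_def using tendsto_fst[OF c(2)] tendsto_snd[OF c(2)] by simp_all
  define f where "f a b s = cross (vec_u a b) (stable_arc N a b s - lozi_fix a b)" for a b s
  have lim_f: "(\<lambda>n. f (A' n) (B' n) (S n)) \<longlonglongrightarrow> f a b s"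
    if "A' \<longlonglongrightarrow> a" "B' \<longlonglongrightarrow> b" "S \<longlonglongrightarrow> s" for A' B' S s
    unfolding f_def using that nz
    by (intro tendsto_cross tendsto_vec tendsto_diff tendsto_stable_arc tendsto_lozi_fix)
  have "(\<lambda>n. f (A n) (B n) s1 * f (A n) (B n) s2) \<longlonglongrightarrow> f a b s1 * f a b s2"
    by (intro tendsto_mult lim_f lim tendsto_const)
  then have ev_f: "eventually (\<lambda>n. f (A n) (B n) s1 * f (A n) (B n) s2 < 0) sequentially"
    using cross by (simp add: f_def order_tendstoD(2))
  have lim_X: "(\<lambda>n. fst (lozi_fix (A n) (B n))) \<longlonglongrightarrow> fst X"
    by (intro tendsto_fst tendsto_lozi_fix lim nz)
  have ev_s: "eventually (\<lambda>n. \<bar>s1\<bar> < fst (lozi_fix (A n) (B n))) sequentially"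
      "eventually (\<lambda>n. \<bar>s2\<bar> < fst (lozi_fix (A n) (B n))) sequentially"
    using order_tendstoD(1)[OF lim_X] small by auto
  have ev_p: "eventually (\<lambda>n. 0 < B n) sequentially" "eventually (\<lambda>n. B n < 1) sequentially"
      "eventually (\<lambda>n. 1 < A n + B n) sequentially"
    using order_tendstoD(1)[OF lim(2) b_pos] order_tendstoD(2)[OF lim(2) b_less]
      order_tendstoD(1)[OF tendsto_add[OF lim] ab] by auto
  have "eventually (\<lambda>n. lozi_params (A n) (B n) \<and> f (A n) (B n) s1 * f (A n) (B n) s2 < 0 \<and>
      \<bar>s1\<bar> < fst (lozi_fix (A n) (B n)) \<and> \<bar>s2\<bar> < fst (lozi_fix (A n) (B n))) sequentially"
    using ev_f ev_s ev_p by eventually_elim (simp add: lozi_params_def)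
  then obtain N0 where N0: "\<And>n. n \<ge> N0 \<Longrightarrow> lozi_params (A n) (B n) \<and> f (A n) (B n) s1 * f (A n) (B n) s2 < 0 \<and>
      \<bar>s1\<bar> < fst (lozi_fix (A n) (B n)) \<and> \<bar>s2\<bar> < fst (lozi_fix (A n) (B n))"
    unfolding eventually_sequentially by blast
  have "\<exists>s\<in>{s1..s2}. f (A n) (B n) s = 0" if n: "n \<ge> N0" for n
  proof -
    interpret n: lozi_params "A n" "B n" using N0[OF n] by simp
    have cf: "continuous_on {s1..s2} (f (A n) (B n))"
      unfolding f_def stable_arc_def
      by (intro continuous_on_cross continuous_intros continuous_on_compose2[OF n.S.cont_iter]) auto
    have sgn: "f (A n) (B n) s1 * f (A n) (B n) s2 < 0" using N0[OF n] by simp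
    show ?thesis
    proof (cases "f (A n) (B n) s1 < 0")
      case True
      then have "f (A n) (B n) s2 > 0" using sgn by (auto simp: mult_less_0_iff)
      then show ?thesis using IVT'[of "f (A n) (B n)" s1 0 s2] True s12 cf by force
    next
      case False
      then have "f (A n) (B n) s1 > 0" "f (A n) (B n) s2 < 0" using sgn by (auto simp: mult_less_0_iff)
      then show ?thesis using IVT2'[of "f (A n) (B n)" s2 0 s1] s12 cf by force
    qed
  qed
  then obtain S where S: "\<And>n. n \<ge> N0 \<Longrightarrow> S n \<in> {s1..s2} \<and> f (A n) (B n) (S n) = 0" by metis
  have "seq_compact {s1..s2}" by (simp add: compact_imp_seq_compact)
  then obtain l \<rho> where l: "l \<in> {s1..s2}" "strict_mono \<rho>" "((\<lambda>n. S (n + N0)) \<circ> \<rho>) \<longlonglongrightarrow> l"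
    using S by (elim seq_compactE[of _ "\<lambda>n. S (n + N0)"]) auto
  define k where "k n = \<rho> n + N0" for n
  have k: "strict_mono k" using l(2) by (simp add: k_def strict_mono_def)
  have kN: "k n \<ge> N0" for n by (simp add: k_def)
  have limk: "(\<lambda>n. A (k n)) \<longlonglongrightarrow> a" "(\<lambda>n. B (k n)) \<longlonglongrightarrow> b" "(\<lambda>n. S (k n)) \<longlonglongrightarrow> l"
    using LIMSEQ_subseq_LIMSEQ[OF lim(1) k] LIMSEQ_subseq_LIMSEQ[OF lim(2) k] l(3)
    by (simp_all add: o_def k_def)
  have "(\<lambda>n. f (A (k n)) (B (k n)) (S (k n))) \<longlonglongrightarrow> f a b l" by (rule lim_f[OF limk])
  then have "f a b l = 0" using S[OF kN] by (simp add: LIMSEQ_const_iff)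
  define d where "d n = \<bar>fst (stable_arc N (A (k n)) (B (k n)) (S (k n))) - fst (lozi_fix (A (k n)) (B (k n)))\<bar>" for n
  define d0 where "d0 = \<bar>fst (stable_arc N a b l) - fst X\<bar>"
  have d0: "0 < d0" "d0 < fst X"
    using hit[of l] l(1) \<open>f a b l = 0\<close> by (auto simp: f_def d0_def)
  have "d \<longlonglongrightarrow> d0"
    unfolding d_def d0_def
    by (intro tendsto_rabs tendsto_diff tendsto_fst tendsto_stable_arc tendsto_lozi_fix limk nz)
  moreover have "(\<lambda>n. fst (lozi_fix (A (k n)) (B (k n)))) \<longlonglongrightarrow> fst X"
    by (intro tendsto_fst tendsto_lozi_fix limk nz)
  ultimately have "eventually (\<lambda>n. 0 < d n) sequentially"
      "eventually (\<lambda>n. 0 < fst (lozi_fix (A (k n)) (B (k n))) - d n) sequentially"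
    using order_tendstoD(1)[of d d0 sequentially 0] d0
      order_tendstoD(1)[OF tendsto_diff, of _ "fst X" sequentially d d0 0] by auto
  then have "eventually (\<lambda>n. 0 < d n \<and> d n < fst (lozi_fix (A (k n)) (B (k n)))) sequentially"
    by eventually_elim simp
  then obtain n where n: "0 < d n" "d n < fst (lozi_fix (A (k n)) (B (k n)))"
    unfolding eventually_sequentially by blast
  define m where "m = k n"
  interpret m: lozi_params "A m" "B m" using N0[OF kN] by (simp add: m_def)
  define T where "T = stable_arc N (A m) (B m) (S m)"
  have Sm: "S m \<in> {s1..s2}" "f (A m) (B m) (S m) = 0" using S[OF kN] by (simp_all add: m_def)
  have "\<bar>S m\<bar> \<le> fst m.X" using Sm(1) N0[OF kN, of n] by (auto simp: m_def abs_le_iff abs_less_iff)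
  then have stable: "T \<in> stable_mfd (A m) (B m)"
    unfolding T_def stable_arc_def by (rule m.stable_preimage)
  have "m.eu \<noteq> 0" using m.b_pos by (simp add: vec_u_def prod_eq_iff)
  then obtain t where t: "T - m.X = t *\<^sub>R m.eu"
    using cross_zero_parallel[of m.eu "T - m.X"] Sm(2) by (auto simp: f_def T_def)
  have Tt: "T = m.X + t *\<^sub>R m.eu" unfolding t[symmetric] by simp
  then have "\<bar>t * m.lu\<bar> = d n" by (simp add: d_def m_def[symmetric] T_def[symmetric] vec_u_def)
  then have "T \<in> unstable_mfd (A m) (B m)"
    unfolding Tt using n by (intro m.unstable_segment) (simp add: m_def)
  moreover have "T \<noteq> m.X" using n(1) by (auto simp: d_def m_def[symmetric] T_def[symmetric])
  ultimately have "homoclinic_point (A m) (B m) T" using stable by (simp add: homoclinic_point_def)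
  then have "(A m, B m) \<in> homoclinic_params"
    unfolding homoclinic_params_def using m.a_pos m.b_pos m.b_less by blast
  then show False using c(1)[of m] by (simp add: A_def B_def)
qed

section \<open>Homoclinic intersections on the boundary\<close>

text \<open>
  At an isolated intersection that is not tangential the stable manifold crosses the unstable one, and
  the crossing, moved into the straight part of the unstable manifold by \<open>n\<close> inverse iterations,
  would put \<open>(a, b)\<close> into the interior of the set of homoclinic parameters.
\<close>

theorem lemma3p5:
  fixes a b :: real
  assumes "(a, b) \<in> frontier homoclinic_params"
    and "0 < b" and "b < 1" and "a + b > 1"
  shows "\<forall>T \<in> unstable_mfd a b \<inter> stable_mfd a b - {lozi_fix a b}.
           \<not> transverse_intersection (unstable_mfd a b) (stable_mfd a b) T \<and>
           (tangential_intersection (unstable_mfd a b) (stable_mfd a b) T \<or>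
            intersect_along_segment (unstable_mfd a b) (stable_mfd a b) T)"
proof
  interpret lozi_params a b using assms by unfold_locales
  fix T assume "T \<in> unstable_mfd a b \<inter> stable_mfd a b - {lozi_fix a b}"
  then have "T \<in> range U.line" "T \<in> range S.line" and TX: "T \<noteq> X"
    unfolding unstable_mfd_eq stable_mfd_eq by simp_all
  then obtain t0 s0 where T: "U.line t0 = T" "S.line s0 = T" by (metis rangeE)
  have not_interior: "(a, b) \<notin> interior homoclinic_params"
    using assms(1) by (simp add: frontier_def)
  have tangential: "tangential_intersection (range U.line) (range S.line) T"
    if iso: "isolated_intersection (range U.line) (range S.line) T"
  proof (rule ccontr)
    assume not_tangential: "\<not> ?thesis"
    obtain n where n: "\<bar>t0\<bar> < fst X / (2 * \<bar>lu\<bar>) * \<bar>lu\<bar> ^ n" using U.reach by blast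
    obtain \<eta> where \<eta>: "\<eta> > 0"
      and change: "U.across ((lozi_inv a b ^^ n) (S.line (s0 - \<eta>))) * U.across ((lozi_inv a b ^^ n) (S.line (s0 + \<eta>))) < 0"
      and only: "\<And>s. \<bar>s - s0\<bar> \<le> \<eta> \<Longrightarrow> U.across ((lozi_inv a b ^^ n) (S.line s)) = 0 \<Longrightarrow> s = s0"
      using U.tangential_or_crossing[OF S.broken_line_axioms T iso n] not_tangential by blast
    obtain M where M: "\<bar>s0\<bar> + \<eta> < fst X / 2 * \<bar>1 / ls\<bar> ^ M" using S.reach by blast
    \<comment> \<open>The parameters of the stable arc and of the stable line differ by the factor \<open>p\<close>.\<close>
    define p where "p = (1 / ls) ^ M"
    have p: "p > 0" using eigenvalue_bounds by (simp add: p_def)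
    have Mp: "\<bar>s0\<bar> + \<eta> < fst X / 2 * p" using M eigenvalue_bounds by (simp add: p_def)
    have arc: "stable_arc (n + M) a b (s / p) = (lozi_inv a b ^^ n) (S.line s)" if "\<bar>s - s0\<bar> \<le> \<eta>" for s
    proof -
      have "\<bar>s\<bar> \<le> fst X / 2 * \<bar>1 / ls\<bar> ^ M" using that M by linarith
      from S.line_eq[OF this] show ?thesis by (simp add: stable_arc_def funpow_add p_def)
    qed
    have side: "cross eu (z - X) = U.across z * cross eu es" for z
      using cross_eu_es by (simp add: U.across_def)
    have tu: "0 < \<bar>t0 / lu ^ n * lu\<bar>" "\<bar>t0 / lu ^ n * lu\<bar> < fst X"
    proof -
      have "t0 \<noteq> 0" using TX T(1) U.line_0 by auto
      then show "0 < \<bar>t0 / lu ^ n * lu\<bar>" using U.mu_nz by simp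
      have "\<bar>t0 / lu ^ n\<bar> < fst X / (2 * \<bar>lu\<bar>)"
        using n U.mu_nz(2)[of n] by (simp only: abs_divide power_abs pos_divide_less_eq)
      then have "\<bar>t0 / lu ^ n\<bar> * \<bar>lu\<bar> < fst X / (2 * \<bar>lu\<bar>) * \<bar>lu\<bar>"
        using U.mu_nz(1) by (intro mult_strict_right_mono) auto
      also have "\<dots> = fst X / 2" using U.mu_nz(1) by simp
      also have "\<dots> < fst X" using fix_coords(1) by simp
      finally show "\<bar>t0 / lu ^ n * lu\<bar> < fst X" by (simp only: abs_mult)
    qed
    have "(a, b) \<in> interior homoclinic_params"
    proof (rule crossing_imp_interior[OF lozi_params_axioms, of "(s0 - \<eta>) / p" "(s0 + \<eta>) / p" "n + M"])
      show "(s0 - \<eta>) / p < (s0 + \<eta>) / p" using \<eta> p by (simp add: divide_strict_right_mono)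
      have "\<bar>s0 - \<eta>\<bar> < fst X * p" "\<bar>s0 + \<eta>\<bar> < fst X * p"
        using Mp \<eta> by auto
      then show "\<bar>(s0 - \<eta>) / p\<bar> < fst X" "\<bar>(s0 + \<eta>) / p\<bar> < fst X"
        using p by (simp_all add: abs_divide pos_divide_less_eq)
      have "U.across (stable_arc (n + M) a b ((s0 - \<eta>) / p)) * U.across (stable_arc (n + M) a b ((s0 + \<eta>) / p)) < 0"
        using change \<eta> by (simp add: arc)
      then have "U.across (stable_arc (n + M) a b ((s0 - \<eta>) / p)) * U.across (stable_arc (n + M) a b ((s0 + \<eta>) / p))
          * (cross eu es)\<^sup>2 < 0"
        using cross_eu_es by (simp add: mult_neg_pos)
      then show "cross eu (stable_arc (n + M) a b ((s0 - \<eta>) / p) - X) *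
          cross eu (stable_arc (n + M) a b ((s0 + \<eta>) / p) - X) < 0"
        by (simp add: side power2_eq_square mult_ac)
      fix s assume s: "(s0 - \<eta>) / p \<le> s" "s \<le> (s0 + \<eta>) / p"
        and zero: "cross eu (stable_arc (n + M) a b s - X) = 0"
      have sp: "\<bar>s * p - s0\<bar> \<le> \<eta>"
        using s p by (simp add: pos_divide_le_eq pos_le_divide_eq abs_le_iff)
      have eq: "stable_arc (n + M) a b s = (lozi_inv a b ^^ n) (S.line (s * p))"
        using arc[OF sp] p by simp
      have "U.across ((lozi_inv a b ^^ n) (S.line (s * p))) = 0"
        using zero cross_eu_es by (simp add: side eq)
      from only[OF sp this] have "stable_arc (n + M) a b s = (lozi_inv a b ^^ n) (U.line t0)"
        using T eq by simp
      also have "\<dots> = X + (t0 / lu ^ n) *\<^sub>R eu"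
        by (subst U.line_eq[OF less_imp_le[OF n]]) (rule U.inv_iter)
      finally have "fst (stable_arc (n + M) a b s) - fst X = t0 / lu ^ n * lu"
        by (simp add: vec_u_def)
      then show "0 < \<bar>fst (stable_arc (n + M) a b s) - fst X\<bar> \<and> \<bar>fst (stable_arc (n + M) a b s) - fst X\<bar> < fst X"
        using tu by (simp only:)
    qed
    then show False using not_interior by simp
  qed
  have segment: "intersect_along_segment (range U.line) (range S.line) T"
    if "\<not> isolated_intersection (range U.line) (range S.line) T"
    using not_isolated_imp_segment[OF U.broken_line_axioms S.broken_line_axioms T that] .
  show "\<not> transverse_intersection (unstable_mfd a b) (stable_mfd a b) T \<and>
      (tangential_intersection (unstable_mfd a b) (stable_mfd a b) T \<or>
       intersect_along_segment (unstable_mfd a b) (stable_mfd a b) T)"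
    unfolding unstable_mfd_eq stable_mfd_eq transverse_intersection_def
    using tangential segment by blast
qed

end
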